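(* Let $q\in L_1(0,\pi)$ be real-valued, let $f,F\in\mathscr R$, and let $\lambda_0<\lambda_1<\lambda_2<\dots$ be the eigenvalues of the problem $\mathscr P(q,f,F)$. For every $n\ge 0$, an eigenfunction of $\mathscr P(q,f,F)$ corresponding to the eigenvalue $\lambda_n$ has exactly $n-\boldsymbol\Pi_f(\lambda_n)-\boldsymbol\Pi_F(\lambda_n)$ zeros in $(0,\pi)$.
   Context: $\mathscr R$ is the set consisting of the symbol $\infty$ together with all rational functions $f(\lambda)=h_0\lambda+h+\sum_{k=1}^d\frac{\delta_k}{h_k-\lambda}$ ($d\ge 0$) with real coefficients, $h_0\ge 0$, $\delta_k>0$, $h_1<\dots<h_d$. For $f\neq\infty$ put $f_\downarrow(\lambda)=h_0'\prod_{k=1}^d(h_k-\lambda)$ with $h_0'=1/h_0$ if $h_0>0$ and $h_0'=1$ if $h_0=0$, and $f_\uparrow=f\cdot f_\downarrow$ (a polynomial); for $f=\infty$ put $f_\uparrow=-1$, $f_\downarrow=0$. $\boldsymbol\Pi_f(\lambda)$ is the number of poles $h_k$ of $f$ with $h_k\le\lambda$ (it is $0$ if $f=\infty$ or $f$ has no poles). $\mathscr P(q,f,F)$ is the boundary value problem $-y''+q(x)y=\lambda y$ on $(0,\pi)$, $\frac{y'(0)}{y(0)}=-f(\lambda)$, $\frac{y'(\pi)}{y(\pi)}=F(\lambda)$, i.e. $f_\downarrow(\lambda)y'(0)+f_\uparrow(\lambda)y(0)=0$ and $F_\downarrow(\lambda)y'(\pi)-F_\uparrow(\lambda)y(\pi)=0$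 (so $\infty$ means a Dirichlet condition, and at a pole of $f$ or $F$ the corresponding condition is Dirichlet). Its eigenvalues are real and simple and form an increasing sequence tending to $+\infty$. *)

theory Defs
  imports "HOL-Analysis.Analysis"
begin

(* "Rational h0 h ps" stands for the function
     h0 * z + h + (SUM k. delta_k / (h_k - z)),
   where ps = [(h_1, delta_1), ..., (h_d, delta_d)].  Under the sign and ordering constraints of
   in_R this representation of a rational function is unique. *)
datatype rfun = Infty | Rational real real "(real \<times> real) list"

fun in_R :: "rfun \<Rightarrow> bool" where
  "in_R Infty \<longleftrightarrow> True"
| "in_R (Rational h0 h ps) \<longleftrightarrow>
     h0 \<ge> 0 \<and> (\<forall>k<length ps. snd (ps ! k) > 0) \<and> sorted_wrt (<) (map fst ps)"

text \<open>All of the following are defined over a generic field extending the reals, so that they can be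
  evaluated at real as well as at complex values of the spectral parameter.\<close>

definition rational_val :: "real \<Rightarrow> real \<Rightarrow> (real \<times> real) list \<Rightarrow> 'a::real_field \<Rightarrow> 'a" where
  "rational_val h0 h ps z = of_real h0 * z + of_real h
     + (\<Sum>k<length ps. of_real (snd (ps ! k)) / (of_real (fst (ps ! k)) - z))"

definition lead_factor :: "real \<Rightarrow> real" where
  "lead_factor h0 = (if h0 > 0 then 1 / h0 else 1)"

fun f_down :: "rfun \<Rightarrow> 'a::real_field \<Rightarrow> 'a" where
  "f_down Infty z = 0"
| "f_down (Rational h0 h ps) z =
     of_real (lead_factor h0) * (\<Prod>k<length ps. of_real (fst (ps ! k)) - z)"

(* The polynomial f * f_down, with the poles cancelled; see f_up_eq below. *)
fun f_up :: "rfun \<Rightarrow> 'a::real_field \<Rightarrow> 'a" where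
  "f_up Infty z = - 1"
| "f_up (Rational h0 h ps) z =
     of_real (lead_factor h0) *
       ((of_real h0 * z + of_real h) * (\<Prod>k<length ps. of_real (fst (ps ! k)) - z)
        + (\<Sum>k<length ps. of_real (snd (ps ! k)) *
             (\<Prod>j\<in>{..<length ps} - {k}. of_real (fst (ps ! j)) - z)))"

lemma f_up_eq:
  fixes z :: "'a::real_field"
  assumes "\<And>k. k < length ps \<Longrightarrow> z \<noteq> of_real (fst (ps ! k))"
  shows "f_up (Rational h0 h ps) z = rational_val h0 h ps z * f_down (Rational h0 h ps) z"
proof -
  let ?g = "\<lambda>k. of_real (fst (ps ! k)) - z"
  have "of_real (snd (ps ! k)) * (\<Prod>j\<in>{..<length ps} - {k}. ?g j)
      = of_real (snd (ps ! k)) / ?g k * (\<Prod>j<length ps. ?g j)" if "k < length ps" for k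
  proof -
    have "?g k \<noteq> 0" using assms[OF that] by auto
    moreover have "(\<Prod>j<length ps. ?g j) = ?g k * (\<Prod>j\<in>{..<length ps} - {k}. ?g j)"
      using that by (simp add: prod.remove)
    ultimately show ?thesis by simp
  qed
  then have "(\<Sum>k<length ps. of_real (snd (ps ! k)) * (\<Prod>j\<in>{..<length ps} - {k}. ?g j))
      = (\<Sum>k<length ps. of_real (snd (ps ! k)) / ?g k) * (\<Prod>j<length ps. ?g j)"
    by (simp add: sum_distrib_right)
  then show ?thesis
    by (simp add: rational_val_def distrib_right mult.left_commute mult.commute distrib_left)
qed

fun pole_count :: "rfun \<Rightarrow> real \<Rightarrow> nat" where
  "pole_count Infty x = 0"
| "pole_count (Rational h0 h ps) x = card {k. k < length ps \<and> fst (ps ! k) \<le> x}"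

(* v is absolutely continuous on [0, pi] with v' = g almost everywhere: on a compact interval the
   absolutely continuous functions are the indefinite integrals of integrable functions, and
   the density is the derivative almost everywhere. *)
definition AC_deriv :: "(real \<Rightarrow> complex) \<Rightarrow> (real \<Rightarrow> complex) \<Rightarrow> bool" where
  "AC_deriv v g \<longleftrightarrow> set_integrable lebesgue {0..pi} g \<and>
     (\<forall>x\<in>{0..pi}. v x = v 0 + (LINT t:{0..x}|lebesgue. g t))"

(* y solves -y'' + q y = mu y on (0, pi) in the sense of Caratheodory, with first derivative y'
   (one-sided at the end points); the density g plays the role of y''. *)
definition SL_solution ::
  "(real \<Rightarrow> real) \<Rightarrow> complex \<Rightarrow> (real \<Rightarrow> complex) \<Rightarrow> (real \<Rightarrow> complex) \<Rightarrow> bool" where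
  "SL_solution q \<mu> y y' \<longleftrightarrow>
     (\<forall>x\<in>{0..pi}. (y has_vector_derivative y' x) (at x within {0..pi})) \<and>
     (\<exists>g. AC_deriv y' g \<and>
        (AE x in lebesgue. x \<in> {0<..<pi} \<longrightarrow> - g x + of_real (q x) * y x = \<mu> * y x))"

definition eigenfunction ::
  "(real \<Rightarrow> real) \<Rightarrow> rfun \<Rightarrow> rfun \<Rightarrow> complex \<Rightarrow> (real \<Rightarrow> complex) \<Rightarrow> bool" where
  "eigenfunction q f F \<mu> y \<longleftrightarrow>
     (\<exists>x\<in>{0..pi}. y x \<noteq> 0) \<and>
     (\<exists>y'. SL_solution q \<mu> y y' \<and>
        f_down f \<mu> * y' 0 + f_up f \<mu> * y 0 = 0 \<and>
        f_down F \<mu> * y' pi - f_up F \<mu> * y pi = 0)"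

definition eigenvalues :: "(real \<Rightarrow> real) \<Rightarrow> rfun \<Rightarrow> rfun \<Rightarrow> complex set" where
  "eigenvalues q f F = {\<mu>. \<exists>y. eigenfunction q f F \<mu> y}"

end

theory Submission
  imports Defs
begin

text \<open>Let \<open>Q\<close> be the primitive of \<open>q\<close> vanishing at \<open>0\<close>. In terms of the quasi-derivative
  \<open>v = y' - Q y\<close> the equation becomes the system \<open>y' = Q y + v\<close>, \<open>v' = -(l + Q\<^sup>2) y - Q v\<close> with continuous
  coefficients, so that only classical solutions occur. Writing \<open>y = r sin \<theta>\<close>, \<open>v = r cos \<theta>\<close> gives
  \<open>\<theta>' = (cos \<theta> + Q sin \<theta>)\<^sup>2 + l (sin \<theta>)\<^sup>2\<close>. The angle \<open>\<theta>\<close> has slope \<open>1\<close> at every multiple of \<open>\<pi>\<close>, hence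
  crosses each of them at most once and upwards, and zeros of \<open>y\<close> are such crossings.

  Both boundary conditions prescribe an angle, namely continuous nondecreasing functions \<open>\<alpha>\<close> and
  \<open>\<beta>\<close> of \<open>l\<close> whose integer parts modulo \<open>\<pi>\<close> are the two pole counts. Start \<open>\<theta>\<close> at \<open>\<alpha>\<close>. Then
  \<open>\<Theta>(l) = \<theta>(\<pi>) + \<beta>(l)\<close> is continuous, strictly increasing, and less than \<open>\<pi>\<close> for small \<open>l\<close>, and \<open>l\<close> is an
  eigenvalue iff \<open>\<Theta>(l)\<close> is a multiple of \<open>\<pi>\<close>. Hence \<open>\<Theta> = (n + 1) \<pi>\<close> at the \<open>n\<close>-th eigenvalue, and
  the zeros are counted by the multiples of \<open>\<pi>\<close> strictly between \<open>\<alpha>\<close> and \<open>(n + 1) \<pi> - \<beta>\<close>.\<close>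

section \<open>Scalar differential equations and inequalities\<close>

text \<open>Banach's fixed point theorem is applied to \<open>exp (- K * x) * \<theta> x\<close>
  instead of \<open>\<theta>\<close>. With this weight the integral operator contracts by the factor
  \<open>L / K\<close> on the whole interval at once, so no local solutions have to be
  glued.\<close>

lemma picard_global:
  fixes G :: "real \<Rightarrow> real \<Rightarrow> real"
  assumes b: "0 \<le> b"
    and cont: "continuous_on ({0..b} \<times> UNIV) (\<lambda>(x, t). G x t)"
    and lip: "\<And>x s t. x \<in> {0..b} \<Longrightarrow> \<bar>G x s - G x t\<bar> \<le> L * \<bar>s - t\<bar>"
  obtains \<theta> where "\<theta> 0 = c"
    and "\<And>x. x \<in> {0..b} \<Longrightarrow> (\<theta> has_real_derivative G x (\<theta> x)) (at x within {0..b})"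
proof -
  have "0 \<le> L"
    using lip[of 0 1 0] b by simp
  \<comment> \<open>Adding \<open>1\<close> keeps \<open>K\<close> positive and
    \<open>L / K < 1\<close> even when \<open>L = 0\<close>.\<close>
  define K where "K = L + 1"
  have K: "0 < K" "0 \<le> L / K" "L / K < 1"
    using \<open>0 \<le> L\<close> by (auto simp: K_def)
  \<comment> \<open>The fixed point is sought among the bounded continuous functions on the whole
    line, a complete space; clamping to \<open>{0..b}\<close> turns functions on the interval into
    members of it.\<close>
  define p where "p x = max 0 (min b x)" for x :: real
  have p_in: "p x \<in> {0..b}" for x
    using b by (auto simp: p_def)
  have p_id: "p x = x" if "x \<in> {0..b}" for x
    using that by (auto simp: p_def)
  have cont_p: "continuous_on UNIV p"
    unfolding p_def by (intro continuous_intros)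
  define g where "g \<phi> s = G s (exp (K * s) * \<phi> s)" for \<phi> s
  have cont_g: "continuous_on {0..b} (g \<phi>)" if "continuous_on UNIV \<phi>" for \<phi>
  proof -
    have "continuous_on {0..b} (\<lambda>s. (\<lambda>(x, t). G x t) (s, exp (K * s) * \<phi> s))"
      using that by (intro continuous_on_compose2[OF cont] continuous_intros)
        (auto intro: continuous_on_subset)
    then show ?thesis by (simp add: g_def)
  qed
  define J where "J \<phi> z = integral {0..z} (g \<phi>)" for \<phi> z
  have J_deriv: "(J \<phi> has_real_derivative g \<phi> x) (at x within {0..b})"
    if "continuous_on UNIV \<phi>" "x \<in> {0..b}" for \<phi> x
    unfolding J_def by (rule integral_has_real_derivative[OF cont_g[OF that(1)] that(2)])
  define T where "T \<phi> x = exp (- K * p x) * (c + J \<phi> (p x))" for \<phi> x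
  have T_bcontfun: "T \<phi> \<in> bcontfun" if "continuous_on UNIV \<phi>" for \<phi>
  proof -
    define h where "h z = exp (- K * z) * (c + J \<phi> z)" for z
    have "continuous_on {0..b} (J \<phi>)"
      by (rule DERIV_continuous_on) (rule J_deriv[OF that])
    then have h: "continuous_on {0..b} h"
      unfolding h_def by (intro continuous_intros)
    then obtain B where "\<And>z. z \<in> {0..b} \<Longrightarrow> norm (h z) \<le> B"
      using compact_imp_bounded[OF compact_continuous_image[OF h]] unfolding bounded_iff by fastforce
    moreover have "continuous_on UNIV (h \<circ> p)"
      using p_in by (intro continuous_on_compose cont_p continuous_on_subset[OF h]) auto
    ultimately have "h \<circ> p \<in> bcontfun"
      using p_in by (intro bcontfun_normI) auto
    then show ?thesis by (simp add: h_def T_def[abs_def] comp_def)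
  qed
  define TT where "TT \<phi> = Bcontfun (T (apply_bcontfun \<phi>))" for \<phi>
  have TT: "apply_bcontfun (TT \<phi>) = T (apply_bcontfun \<phi>)" for \<phi>
    unfolding TT_def by (rule Bcontfun_inverse) (rule T_bcontfun, simp)
  have dist_T: "dist (TT \<phi>) (TT \<psi>) \<le> L / K * dist \<phi> \<psi>" for \<phi> \<psi>
  proof (rule dist_bound)
    fix x
    define z where "z = p x"
    define D where "D = dist \<phi> \<psi>"
    have z: "z \<in> {0..b}" unfolding z_def by (rule p_in)
    have int: "(g \<phi>) integrable_on {0..z}" if "continuous_on UNIV \<phi>" for \<phi>
      using z that by (intro integrable_continuous_real continuous_on_subset[OF cont_g]) auto
    \<comment> \<open>Integrating the weight \<open>exp (K * s)\<close> produces the factor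
      \<open>1 / K\<close> that makes the operator a contraction.\<close>
    have exp_int: "((\<lambda>s. L * D * exp (K * s)) has_integral (L * D * exp (K * z) / K - L * D * exp (K * 0) / K)) {0..z}"
      using z K by (intro fundamental_theorem_of_calculus)
        (auto intro!: derivative_eq_intros simp: has_real_derivative_iff_has_vector_derivative[symmetric])
    have "\<bar>J \<phi> z - J \<psi> z\<bar> = norm (integral {0..z} (\<lambda>s. g \<phi> s - g \<psi> s))"
      unfolding J_def by (subst integral_diff) (auto intro!: int)
    also have "\<dots> \<le> integral {0..z} (\<lambda>s. L * D * exp (K * s))"
    proof (rule integral_norm_bound_integral)
      fix s assume s: "s \<in> {0..z}"
      have le: "\<bar>g \<phi> s - g \<psi> s\<bar> \<le> L * \<bar>exp (K * s) * \<phi> s - exp (K * s) * \<psi> s\<bar>"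
        unfolding g_def using s z by (intro lip) auto
      have "\<bar>exp (K * s) * \<phi> s - exp (K * s) * \<psi> s\<bar> = exp (K * s) * dist (\<phi> s) (\<psi> s)"
        by (simp add: dist_real_def abs_mult flip: right_diff_distrib)
      also have "\<dots> \<le> exp (K * s) * D"
        unfolding D_def by (intro mult_left_mono dist_bounded) auto
      finally show "norm (g \<phi> s - g \<psi> s) \<le> L * D * exp (K * s)"
        using le mult_left_mono[OF _ \<open>0 \<le> L\<close>] by (fastforce simp: mult_ac)
    next
      show "(\<lambda>s. g \<phi> s - g \<psi> s) integrable_on {0..z}"
        by (intro integrable_diff int) auto
    qed (rule has_integral_integrable[OF exp_int])
    also have "\<dots> \<le> L * D * exp (K * z) / K"
      unfolding integral_unique[OF exp_int] using K \<open>0 \<le> L\<close> by (simp add: D_def)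
    finally have "\<bar>J \<phi> z - J \<psi> z\<bar> \<le> L * D * exp (K * z) / K" .
    then have "exp (- K * z) * \<bar>J \<phi> z - J \<psi> z\<bar> \<le> exp (- K * z) * (L * D * exp (K * z) / K)"
      by (intro mult_left_mono) auto
    also have "\<dots> = L / K * D"
      by (simp add: exp_minus field_simps)
    finally show "dist (TT \<phi> x) (TT \<psi> x) \<le> L / K * dist \<phi> \<psi>"
      by (simp add: TT T_def dist_real_def abs_mult D_def z_def flip: right_diff_distrib)
  qed
  obtain \<phi> where \<phi>: "TT \<phi> = \<phi>"
    using banach_fix_type[OF K(2,3)] dist_T by blast
  have fixed_point: "exp (K * x) * \<phi> x = c + J \<phi> x" if "x \<in> {0..b}" for x
  proof -
    have "\<phi> x = exp (- K * x) * (c + J \<phi> x)"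
      using fun_cong[OF TT[of \<phi>], of x] that by (simp add: \<phi> T_def p_id)
    then show ?thesis by (simp add: exp_minus field_simps)
  qed
  show ?thesis
  proof (rule that[of "\<lambda>x. c + J \<phi> x"])
    show "c + J \<phi> 0 = c" by (simp add: J_def)
    fix x assume x: "x \<in> {0..b}"
    have "((\<lambda>x. c + J \<phi> x) has_real_derivative g \<phi> x) (at x within {0..b})"
      using J_deriv[OF _ x, of \<phi>] by (auto intro!: derivative_eq_intros)
    then show "((\<lambda>x. c + J \<phi> x) has_real_derivative G x (c + J \<phi> x)) (at x within {0..b})"
      by (simp add: g_def fixed_point[OF x])
  qed
qed

text \<open>A comparison principle. Where \<open>d\<close> is negative,
  \<open>exp (- L * x) * d x\<close> is nondecreasing, so \<open>d\<close> cannot descend below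
  \<open>0\<close>. Where \<open>d\<close> is nonnegative, \<open>exp (L * x) * d x\<close> is
  nondecreasing, so a zero at \<open>x\<close> forces \<open>d\<close> to vanish on all of
  \<open>{a..x}\<close>, and then \<open>d' = 0\<close> leaves no room for a positive
  \<open>e\<close>. Strict inequalities come from this second part.\<close>

lemma differential_inequality:
  fixes d d' e :: "real \<Rightarrow> real"
  assumes der: "\<And>x. x \<in> {a..b} \<Longrightarrow> (d has_real_derivative d' x) (at x within {a..b})"
    and ge: "\<And>x. x \<in> {a..b} \<Longrightarrow> d' x \<ge> e x - L * \<bar>d x\<bar>"
    and e: "\<And>x. x \<in> {a..b} \<Longrightarrow> 0 \<le> e x"
    and da: "0 \<le> d a"
    and x: "x \<in> {a..b}"
  shows "0 \<le> d x"
    and "\<lbrakk>d x = 0; a < t; t < x\<rbrakk> \<Longrightarrow> d t = 0 \<and> e t = 0"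
proof -
  have cont: "continuous_on {a..b} d"
    by (rule DERIV_continuous_on) (rule der)
  have DERIV: "(d has_real_derivative d' t) (at t)" if "a < t" "t < b" for t
    using der[of t] that by (simp add: at_within_Icc_at)
  have weighted: "exp (C * u) * d u \<le> exp (C * v) * d v"
    if uv: "a \<le> u" "u \<le> v" "v \<le> b" and C: "\<And>t. u < t \<Longrightarrow> t < v \<Longrightarrow> d' t + C * d t \<ge> 0" for u v C
  proof (rule DERIV_nonneg_imp_increasing_open[of u v "\<lambda>t. exp (C * t) * d t"])
    fix t assume t: "u < t" "t < v"
    have "((\<lambda>t. exp (C * t) * d t) has_real_derivative exp (C * t) * (d' t + C * d t)) (at t)"
      using DERIV[of t] t uv by (auto intro!: derivative_eq_intros simp: algebra_simps)
    then show "\<exists>y. ((\<lambda>t. exp (C * t) * d t) has_real_derivative y) (at t) \<and> 0 \<le> y"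
      using C[OF t] by force
  next
    show "continuous_on {u..v} (\<lambda>t. exp (C * t) * d t)"
      using uv by (intro continuous_intros continuous_on_subset[OF cont]) auto
  qed (rule uv)
  have nonneg: "0 \<le> d x" if x: "x \<in> {a..b}" for x
  proof (rule ccontr)
    assume neg: "\<not> 0 \<le> d x"
    define S where "S = {a..x} \<inter> d -` {0..}"
    have "closed S"
      unfolding S_def using x by (intro continuous_closed_preimage continuous_on_subset[OF cont]) auto
    moreover have "a \<in> S" using da x by (auto simp: S_def)
    moreover have bdd: "bdd_above S" by (auto simp: S_def)
    ultimately have sup: "Sup S \<in> S" by (intro closed_contains_Sup) auto
    \<comment> \<open>The last point of \<open>{a..x}\<close> with \<open>d \<ge> 0\<close>; beyond
      it \<open>d\<close> is negative and \<open>- L * \<bar>d t\<bar> = L * d t\<close>.\<close>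
    define u where "u = Sup S"
    have u: "a \<le> u" "u \<le> x" "0 \<le> d u" using sup by (auto simp: S_def u_def)
    have lt: "d t < 0" if "u < t" "t \<le> x" for t
    proof (rule ccontr)
      assume "\<not> d t < 0"
      then have "t \<in> S" using that u by (auto simp: S_def)
      then have "t \<le> u" unfolding u_def by (rule cSup_upper[OF _ bdd])
      then show False using that by simp
    qed
    have "exp (- L * u) * d u \<le> exp (- L * x) * d x"
    proof (rule weighted)
      fix t assume t: "u < t" "t < x"
      show "0 \<le> d' t + - L * d t"
        using ge[of t] e[of t] lt[of t] t u x by auto
    qed (use u x in auto)
    then show False using neg u(3) 
      by (smt (verit) exp_gt_zero mult_nonneg_nonneg mult_pos_neg)
  qed
  then show "0 \<le> d x" using x .
  assume 0: "d x = 0" "a < t" "t < x"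
  have zero: "d s = 0" if "a \<le> s" "s \<le> x" for s
  proof -
    have "exp (L * s) * d s \<le> exp (L * x) * d x"
    proof (rule weighted)
      fix t assume t: "s < t" "t < x"
      show "0 \<le> d' t + L * d t"
        using ge[of t] e[of t] nonneg[of t] t that x by auto
    qed (use that x in auto)
    then have "d s \<le> 0"
      by (simp add: 0 mult_le_0_iff)
    then show ?thesis using nonneg[of s] that x by auto
  qed
  have "d' t = 0"
  proof -
    have "(d has_real_derivative 0) (at t)"
    proof (rule has_field_derivative_transform_within_open[of "\<lambda>_. 0" _ _ "{a<..<x}"])
      show "((\<lambda>_. 0) has_real_derivative 0) (at t)" by simp
    qed (use 0 zero in auto)
    then show ?thesis using DERIV[of t] 0 x by (auto dest: DERIV_unique)
  qed
  then show "d t = 0 \<and> e t = 0"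
    using zero[of t] ge[of t] e[of t] 0 x by auto
qed

section \<open>The angle equation\<close>

lemma abs_sin_diff_le: "\<bar>sin s - sin t\<bar> \<le> \<bar>s - t\<bar>" for s t :: real
proof -
  have "\<bar>sin s - sin t\<bar> = 2 * \<bar>sin ((s - t) / 2)\<bar> * \<bar>cos ((s + t) / 2)\<bar>"
    by (simp add: sin_diff_sin abs_mult)
  also have "\<dots> \<le> 2 * \<bar>(s - t) / 2\<bar> * 1"
    by (intro mult_mono abs_sin_x_le_abs_x) auto
  finally show ?thesis by simp
qed

lemma abs_cos_diff_le: "\<bar>cos s - cos t\<bar> \<le> \<bar>s - t\<bar>" for s t :: real
  using abs_sin_diff_le[of "s + pi / 2" "t + pi / 2"] by (simp add: sin_add)

locale prufer =
  fixes Q :: "real \<Rightarrow> real" and M :: real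
  assumes continuous_Q: "continuous_on {0..pi} Q"
    and bound_Q: "\<And>x. x \<in> {0..pi} \<Longrightarrow> \<bar>Q x\<bar> \<le> M"
begin

definition G :: "real \<Rightarrow> real \<Rightarrow> real \<Rightarrow> real" where
  "G l x t = (cos t + Q x * sin t)\<^sup>2 + l * (sin t)\<^sup>2"

text \<open>A Lipschitz constant of \<open>G l x\<close> in the angle, uniform in \<open>x\<close>:
  the first term comes from the square of a function that is bounded by \<open>1 + M\<close> and has
  Lipschitz constant \<open>1 + M\<close>, the second from \<open>(sin t)\<^sup>2\<close>.\<close>

definition Lip :: "real \<Rightarrow> real" where
  "Lip l = 2 * (1 + M)\<^sup>2 + 2 * \<bar>l\<bar>"

lemma M_nonneg: "0 \<le> M"
  using bound_Q[of 0] by simp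

lemma Lip_nonneg: "0 \<le> Lip l"
  by (simp add: Lip_def)

lemma abs_cos_Q_sin_le:
  assumes "x \<in> {0..pi}"
  shows "\<bar>cos t + Q x * sin t\<bar> \<le> 1 + M"
proof -
  have "\<bar>Q x * sin t\<bar> \<le> M * 1"
    unfolding abs_mult using bound_Q[OF assms] M_nonneg by (intro mult_mono) auto
  then show ?thesis using abs_cos_le_one[of t] by linarith
qed

lemma G_Lipschitz:
  assumes "x \<in> {0..pi}"
  shows "\<bar>G l x s - G l x t\<bar> \<le> Lip l * \<bar>s - t\<bar>"
proof -
  define A where "A t = cos t + Q x * sin t" for t
  have A: "\<bar>A t\<bar> \<le> 1 + M" for t
    unfolding A_def by (rule abs_cos_Q_sin_le[OF assms])
  have "\<bar>A s - A t\<bar> \<le> \<bar>cos s - cos t\<bar> + \<bar>Q x\<bar> * \<bar>sin s - sin t\<bar>"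
    by (simp add: A_def algebra_simps flip: abs_mult)
  also have "\<dots> \<le> \<bar>s - t\<bar> + M * \<bar>s - t\<bar>"
    using bound_Q[OF assms] M_nonneg by (intro add_mono mult_mono abs_cos_diff_le abs_sin_diff_le) auto
  finally have 1: "\<bar>A s - A t\<bar> \<le> (1 + M) * \<bar>s - t\<bar>" by (simp add: algebra_simps)
  have 2: "\<bar>A s + A t\<bar> \<le> 2 * (1 + M)" using order_trans[OF abs_triangle_ineq add_mono[OF A[of s] A[of t]]] by simp
  have "\<bar>A s ^ 2 - A t ^ 2\<bar> = \<bar>A s - A t\<bar> * \<bar>A s + A t\<bar>"
    by (simp add: power2_eq_square algebra_simps flip: abs_mult)
  also have "\<dots> \<le> ((1 + M) * \<bar>s - t\<bar>) * (2 * (1 + M))"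
    using 1 2 M_nonneg by (intro mult_mono) auto
  finally have 3: "\<bar>A s ^ 2 - A t ^ 2\<bar> \<le> 2 * (1 + M)\<^sup>2 * \<bar>s - t\<bar>"
    by (simp add: power2_eq_square algebra_simps)
  have "\<bar>sin s ^ 2 - sin t ^ 2\<bar> = \<bar>sin s - sin t\<bar> * \<bar>sin s + sin t\<bar>"
    by (simp add: power2_eq_square algebra_simps flip: abs_mult)
  also have "\<dots> \<le> \<bar>s - t\<bar> * 2"
    using order_trans[OF abs_triangle_ineq add_mono[OF abs_sin_le_one[of s] abs_sin_le_one[of t]]]
    by (intro mult_mono abs_sin_diff_le) auto
  finally have "\<bar>l\<bar> * \<bar>sin s ^ 2 - sin t ^ 2\<bar> \<le> \<bar>l\<bar> * (2 * \<bar>s - t\<bar>)"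
    by (intro mult_left_mono) auto
  then have "\<bar>l * (sin s ^ 2 - sin t ^ 2)\<bar> \<le> 2 * \<bar>l\<bar> * \<bar>s - t\<bar>"
    by (simp add: abs_mult)
  moreover have "G l x s - G l x t = (A s ^ 2 - A t ^ 2) + l * (sin s ^ 2 - sin t ^ 2)"
    by (simp add: G_def A_def algebra_simps)
  ultimately show ?thesis using 3 unfolding Lip_def by (simp add: distrib_right)
qed

lemma G_multiple_of_pi: "sin t = 0 \<Longrightarrow> G l x t = 1"
  using sin_cos_squared_add[of t] by (simp add: G_def)

text \<open>Uniqueness of the solution is never needed, so an arbitrary one is chosen.\<close>

definition angle :: "real \<Rightarrow> real \<Rightarrow> real \<Rightarrow> real" where
  "angle a l = (SOME \<theta>. \<theta> 0 = a \<and>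
     (\<forall>x\<in>{0..pi}. (\<theta> has_real_derivative G l x (\<theta> x)) (at x within {0..pi})))"

lemma angle_0: "angle a l 0 = a"
  and angle_deriv: "x \<in> {0..pi} \<Longrightarrow>
    (angle a l has_real_derivative G l x (angle a l x)) (at x within {0..pi})"
proof -
  have "continuous_on ({0..pi} \<times> UNIV) (\<lambda>(x, t). G l x t)"
    unfolding G_def case_prod_beta
    by (intro continuous_intros continuous_on_compose2[OF continuous_Q]) auto
  then obtain \<theta> where "\<theta> 0 = a"
    "\<And>x. x \<in> {0..pi} \<Longrightarrow> (\<theta> has_real_derivative G l x (\<theta> x)) (at x within {0..pi})"
    by (rule picard_global[OF pi_ge_zero _ G_Lipschitz]) auto
  then have "\<exists>\<theta>. \<theta> 0 = a \<and>
     (\<forall>x\<in>{0..pi}. (\<theta> has_real_derivative G l x (\<theta> x)) (at x within {0..pi}))"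
    by blast
  from someI_ex[OF this] show "angle a l 0 = a"
    "x \<in> {0..pi} \<Longrightarrow> (angle a l has_real_derivative G l x (angle a l x)) (at x within {0..pi})"
    unfolding angle_def[symmetric] by auto
qed

lemma continuous_on_angle: "continuous_on {0..pi} (angle a l)"
  by (rule DERIV_continuous_on) (rule angle_deriv)

text \<open>A constant multiple of \<pi> is a strict subsolution, because \<open>G\<close> equals
  \<open>1\<close> there. The difference to the angle satisfies the differential inequality with
  \<open>e = 1\<close>, and since \<open>e\<close> never vanishes the conclusion is strict.\<close>

lemma angle_crossing:
  assumes "sin t = 0" "t \<le> angle a l x\<^sub>0" "0 \<le> x\<^sub>0" "x\<^sub>0 < x" "x \<le> pi"
  shows "t < angle a l x"
proof -
  define d where "d x = angle a l x - t" for x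
  have der: "(d has_real_derivative G l x (angle a l x)) (at x within {x\<^sub>0..pi})" if "x \<in> {x\<^sub>0..pi}" for x
    unfolding d_def using that assms
    by (auto intro!: derivative_eq_intros DERIV_subset[OF angle_deriv])
  have ge: "G l x (angle a l x) \<ge> 1 - Lip l * \<bar>d x\<bar>" if "x \<in> {x\<^sub>0..pi}" for x
    using G_Lipschitz[of x l "angle a l x" t] G_multiple_of_pi[OF assms(1), of l x] that assms
    by (auto simp: d_def)
  note di = differential_inequality[OF der ge]
  have "0 \<le> d x"
    by (rule di(1)) (use assms in \<open>auto simp: d_def\<close>)
  moreover have "d x \<noteq> 0"
    using di(2)[of x "(x\<^sub>0 + x) / 2"] assms by (auto simp: d_def)
  ultimately show ?thesis by (simp add: d_def)
qed

text \<open>If the sine vanished throughout, its derivative at \<open>pi / 2\<close> would be both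
  \<open>0\<close> and the cosine of a multiple of \<pi>. The lemma gives strictness in the spectral
  parameter and the nontriviality of the polar solution.\<close>

lemma sin_angle_neq_0: "\<exists>x\<in>{0<..<pi}. sin (angle a l x) \<noteq> 0"
proof (rule ccontr)
  assume "\<not> ?thesis"
  then have zero: "sin (angle a l x) = 0" if "x \<in> {0<..<pi}" for x
    using that by blast
  define t where "t = angle a l (pi / 2)"
  have "pi / 2 \<in> {0<..<pi}" by simp
  have "(angle a l has_real_derivative G l (pi / 2) t) (at (pi / 2))"
    using angle_deriv[of "pi / 2" a l] by (simp add: at_within_Icc_at t_def)
  moreover have "G l (pi / 2) t = 1"
    using zero[OF \<open>pi / 2 \<in> {0<..<pi}\<close>] by (intro G_multiple_of_pi) (simp add: t_def)
  ultimately have "((\<lambda>x. sin (angle a l x)) has_real_derivative cos t) (at (pi / 2))"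
    by (auto intro!: derivative_eq_intros simp: t_def)
  moreover have "((\<lambda>x. sin (angle a l x)) has_real_derivative 0) (at (pi / 2))"
    by (rule has_field_derivative_transform_within_open[of "\<lambda>_. 0" _ _ "{0<..<pi}"]) (auto simp: zero)
  ultimately have "cos t = 0" by (rule DERIV_unique)
  moreover have "sin t = 0" using zero[OF \<open>pi / 2 \<in> {0<..<pi}\<close>] by (simp add: t_def)
  ultimately show False using sin_zero_abs_cos_one by fastforce
qed

section \<open>Dependence of the final angle on the initial angle and the spectral parameter\<close>

lemma angle_strict_mono:
  assumes "a \<le> a'" "l < l'"
  shows "angle a l pi < angle a' l' pi"
proof -
  define d where "d x = angle a' l' x - angle a l x" for x
  have der: "(d has_real_derivative G l' x (angle a' l' x) - G l x (angle a l x)) (at x within {0..pi})"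
    if "x \<in> {0..pi}" for x
    unfolding d_def using that by (auto intro!: derivative_eq_intros angle_deriv)
  \<comment> \<open>The gain from increasing the parameter is
    \<open>(l' - l) * (sin (angle a' l' x))\<^sup>2\<close>, which serves as \<open>e\<close>;
    equality at \<open>pi\<close> would make this sine vanish on the whole open interval.\<close>
  have ge: "G l' x (angle a' l' x) - G l x (angle a l x)
      \<ge> (l' - l) * (sin (angle a' l' x))\<^sup>2 - Lip l * \<bar>d x\<bar>" if "x \<in> {0..pi}" for x
  proof -
    have "G l' x (angle a' l' x) = G l x (angle a' l' x) + (l' - l) * (sin (angle a' l' x))\<^sup>2"
      by (simp add: G_def algebra_simps)
    then show ?thesis
      using G_Lipschitz[OF that, of l "angle a' l' x" "angle a l x"] by (simp add: d_def)
  qed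
  note di = differential_inequality[OF der ge]
  have "0 \<le> d pi"
    by (rule di(1)) (use assms in \<open>auto simp: d_def angle_0\<close>)
  moreover have "d pi \<noteq> 0"
  proof
    assume "d pi = 0"
    then have "sin (angle a' l' x) = 0" if "0 < x" "x < pi" for x
      using di(2)[of pi x] that assms by (auto simp: d_def angle_0)
    then show False using sin_angle_neq_0[of a' l'] by auto
  qed
  ultimately show ?thesis by (simp add: d_def)
qed

text \<open>A Gronwall estimate. The bound \<open>E x = \<eta> * ((1 + x) * exp (L * x))\<close>,
  where \<open>L = Lip l\<close>, starts at \<eta> and satisfies
  \<open>E' \<ge> L * E + \<eta>\<close>, which dominates the growth of the difference of the
  angles. As only \<open>Lip l\<close> enters, the factor of \<eta> stays fixed while
  \<open>l'\<close> varies, as continuity at \<open>l\<close> requires.\<close>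

lemma angle_diff_le:
  assumes "\<bar>a' - a\<bar> \<le> \<eta>" "\<bar>l' - l\<bar> \<le> \<eta>"
  shows "\<bar>angle a' l' pi - angle a l pi\<bar> \<le> \<eta> * ((1 + pi) * exp (Lip l * pi))"
proof -
  have "0 \<le> \<eta>" using assms by linarith
  \<comment> \<open>The signs \<open>s = 1\<close> and \<open>s = -1\<close> give the lower and the
    upper bound.\<close>
  have main: "0 \<le> s * (angle a' l' pi - angle a l pi) + \<eta> * ((1 + pi) * exp (Lip l * pi))"
    if s: "\<bar>s\<bar> = 1" for s
  proof -
    let ?L = "Lip l"
    define E where "E x = \<eta> * ((1 + x) * exp (?L * x))" for x
    define d where "d x = s * (angle a' l' x - angle a l x) + E x" for x
    define d' where "d' x = s * (G l' x (angle a' l' x) - G l x (angle a l x))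
      + \<eta> * (exp (?L * x) + (1 + x) * (exp (?L * x) * ?L))" for x
    have "0 \<le> d pi"
    proof (rule differential_inequality(1)[where d = d and d' = d' and e = "\<lambda>_. 0" and L = ?L])
      show "(d has_real_derivative d' x) (at x within {0..pi})" if "x \<in> {0..pi}" for x
        unfolding d_def d'_def E_def using that
        by (auto intro!: derivative_eq_intros angle_deriv)
      show "d' x \<ge> 0 - ?L * \<bar>d x\<bar>" if x: "x \<in> {0..pi}" for x
      proof -
        define \<Delta> where "\<Delta> = angle a' l' x - angle a l x"
        have "E x \<ge> 0" using x \<open>0 \<le> \<eta>\<close> by (simp add: E_def)
        have eq: "G l' x (angle a' l' x) = G l x (angle a' l' x) + (l' - l) * (sin (angle a' l' x))\<^sup>2"
          by (simp add: G_def algebra_simps)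
        have "\<bar>(l' - l) * (sin (angle a' l' x))\<^sup>2\<bar> \<le> \<eta> * 1"
          unfolding abs_mult using assms by (intro mult_mono) (auto simp: abs_square_le_1)
        then have "\<bar>G l' x (angle a' l' x) - G l x (angle a l x)\<bar> \<le> ?L * \<bar>\<Delta>\<bar> + \<eta>"
          using G_Lipschitz[OF x, of l "angle a' l' x" "angle a l x"]
          unfolding eq \<Delta>_def by linarith
        then have "s * (G l' x (angle a' l' x) - G l x (angle a l x)) \<ge> - (?L * \<bar>\<Delta>\<bar> + \<eta>)"
          using s by (cases "s = 1") (auto simp: abs_if split: if_splits)
        moreover have "\<eta> * exp (?L * x) \<ge> \<eta> * 1"
          using \<open>0 \<le> \<eta>\<close> x Lip_nonneg[of l] by (intro mult_left_mono) auto
        moreover have "\<bar>\<Delta>\<bar> \<le> \<bar>d x\<bar> + E x"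
          using s \<open>E x \<ge> 0\<close> by (cases "s = 1") (auto simp: d_def \<Delta>_def abs_if split: if_splits)
        then have "?L * \<bar>\<Delta>\<bar> \<le> ?L * (\<bar>d x\<bar> + E x)"
          using Lip_nonneg by (rule mult_left_mono)
        moreover have "d' x = s * (G l' x (angle a' l' x) - G l x (angle a l x)) + \<eta> * exp (?L * x) + ?L * E x"
          by (simp add: d'_def E_def algebra_simps)
        ultimately show ?thesis by (simp add: distrib_left)
      qed
      show "0 \<le> d 0"
        using assms s by (cases "s = 1") (auto simp: d_def E_def angle_0 abs_if split: if_splits)
    qed auto
    then show ?thesis by (simp add: d_def E_def)
  qed
  from main[of 1] main[of "-1"] show ?thesis by (simp add: abs_le_iff)
qed

text \<open>The straight line from \<open>c\<close> at \<open>0\<close> to \<epsilon> at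
  \<open>pi\<close> is an upper barrier. It stays inside the open interval from \<open>0\<close> to
  \<pi>, where the sine is bounded away from \<open>0\<close>, so for very negative \<open>l\<close>
  the value of \<open>G\<close> along it is at most its slope.\<close>

lemma angle_small:
  assumes "0 < \<epsilon>" "\<epsilon> \<le> c" "c < pi"
  obtains l\<^sub>0 where "\<And>l a. l \<le> l\<^sub>0 \<Longrightarrow> a \<le> c \<Longrightarrow> angle a l pi \<le> \<epsilon>"
proof -
  have "continuous_on {\<epsilon>..c} (sin :: real \<Rightarrow> real)"
    by (intro continuous_intros)
  then obtain t where t: "t \<in> {\<epsilon>..c}" "\<And>u. u \<in> {\<epsilon>..c} \<Longrightarrow> sin t \<le> sin u"
    using continuous_attains_inf[of "{\<epsilon>..c}" sin] assms by auto
  define s where "s = sin t"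
  have "0 < s" unfolding s_def using t assms by (intro sin_gt_zero) auto
  define m where "m = (\<epsilon> - c) / pi"
  \<comment> \<open>Chosen so that \<open>l * s\<^sup>2 \<le> m - (1 + M)\<^sup>2\<close> for
    \<open>l \<le> l\<^sub>0\<close>, with \<open>(1 + M)\<^sup>2\<close> bounding the other term of
    \<open>G\<close>; the minimum with \<open>0\<close> allows \<open>s\<close> to be replaced by
    larger values of the sine.\<close>
  define l\<^sub>0 where "l\<^sub>0 = min 0 ((m - (1 + M)\<^sup>2) / s\<^sup>2)"
  show ?thesis
  proof (rule that[of l\<^sub>0])
    fix l a assume l: "l \<le> l\<^sub>0" and a: "a \<le> c"
    define g where "g x = c + m * x" for x
    have g: "\<epsilon> \<le> g x" "g x \<le> c" if "x \<in> {0..pi}" for x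
    proof -
      have "(c - \<epsilon>) * (x / pi) \<le> (c - \<epsilon>) * 1"
        using that assms by (intro mult_left_mono) auto
      then show "\<epsilon> \<le> g x" by (simp add: g_def m_def field_simps)
      have "0 \<le> (c - \<epsilon>) * x / pi" using that assms by simp
      then show "g x \<le> c" by (simp add: g_def m_def field_simps)
    qed
    define d where "d x = g x - angle a l x" for x
    have "0 \<le> d pi"
    proof (rule differential_inequality(1)[where d = d and e = "\<lambda>_. 0" and L = "Lip l"])
      show "(d has_real_derivative m - G l x (angle a l x)) (at x within {0..pi})"
        if "x \<in> {0..pi}" for x
        unfolding d_def g_def using that by (auto intro!: derivative_eq_intros angle_deriv)
      show "m - G l x (angle a l x) \<ge> 0 - Lip l * \<bar>d x\<bar>" if x: "x \<in> {0..pi}" for x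
      proof -
        have "s\<^sup>2 \<le> (sin (g x))\<^sup>2"
          using t(2)[of "g x"] g[OF x] \<open>0 < s\<close> by (intro power_mono) (auto simp: s_def)
        moreover have "l \<le> 0" "l \<le> (m - (1 + M)\<^sup>2) / s\<^sup>2"
          using l by (auto simp: l\<^sub>0_def)
        then have "l * s\<^sup>2 \<le> m - (1 + M)\<^sup>2" using \<open>0 < s\<close> by (simp add: field_simps)
        ultimately have "l * (sin (g x))\<^sup>2 \<le> m - (1 + M)\<^sup>2"
          using mult_left_mono_neg[of "s\<^sup>2" "(sin (g x))\<^sup>2" l] \<open>l \<le> 0\<close> by linarith
        moreover have "(cos (g x) + Q x * sin (g x))\<^sup>2 \<le> (1 + M)\<^sup>2"
          using abs_cos_Q_sin_le[OF x, of "g x"] M_nonneg by (simp add: abs_le_square_iff[symmetric])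
        ultimately have "G l x (g x) \<le> m" by (simp add: G_def)
        then show ?thesis
          using G_Lipschitz[OF x, of l "g x" "angle a l x"] by (simp add: d_def)
      qed
      show "0 \<le> d 0" using a by (simp add: d_def g_def angle_0)
    qed auto
    then show "angle a l pi \<le> \<epsilon>" by (simp add: d_def g_def m_def)
  qed
qed

end

section \<open>The angles of the boundary conditions\<close>

lemma f_down_of_real: "f_down f (of_real x :: 'a::real_field) = of_real (f_down f x)"
  by (cases f) simp_all

lemma f_up_of_real: "f_up f (of_real x :: 'a::real_field) = of_real (f_up f x)"
  by (cases f) simp_all

text \<open>The continuous branch of the angle \<open>\<alpha>\<close> with cotangent \<open>- f(l)\<close>; it passes the multiple
  \<open>k \<pi>\<close> exactly at the \<open>k\<close>-th pole of \<open>f\<close>.\<close>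

fun boundary_angle :: "rfun \<Rightarrow> real \<Rightarrow> real" where
  "boundary_angle Infty l = 0"
| "boundary_angle (Rational h0 h ps) l = pi * real (pole_count (Rational h0 h ps) l)
     + (if l \<in> fst ` set ps then 0 else pi / 2 + arctan (rational_val h0 h ps l))"

lemma boundary_angle_bounds:
  "pi * real (pole_count f l) \<le> boundary_angle f l"
  "boundary_angle f l < pi * real (pole_count f l + 1)"
proof -
  have "pi * real (pole_count f l) \<le> boundary_angle f l \<and>
    boundary_angle f l < pi * real (pole_count f l + 1)"
  proof (cases f)
    case (Rational h0 h ps)
    show ?thesis
      using pi_gt_zero arctan_bounded[of "rational_val h0 h ps l"]
      unfolding Rational boundary_angle.simps of_nat_add distrib_left
      by (auto simp del: pole_count.simps)
  qed auto
  then show "pi * real (pole_count f l) \<le> boundary_angle f l"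
    "boundary_angle f l < pi * real (pole_count f l + 1)" by auto
qed

lemma pole_nth_iff: "l \<in> fst ` set ps \<longleftrightarrow> (\<exists>k<length ps. l = fst (ps ! k))"
  by (force simp: in_set_conv_nth)

lemma pole_nth_eq:
  assumes "in_R (Rational h0 h ps)" "j < length ps" "k < length ps" "fst (ps ! j) = fst (ps ! k)"
  shows "j = k"
proof -
  have "distinct (map fst ps)"
    using assms(1) by (simp add: strict_sorted_iff)
  then show ?thesis
    using assms(2-) by (simp add: distinct_conv_nth) metis
qed

text \<open>Away from the poles the cotangent of the angle is \<open>- f\<close>. At a pole
  \<open>f_down\<close> and the sine both vanish, while in \<open>f_up\<close> exactly the summand
  of that pole survives, nonzero since the poles are distinct and the residue weights positive. The
  second claim says that the condition determines a unique direction.\<close>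

lemma boundary_angle_condition:
  assumes "in_R f"
  shows "f_down f l * cos (boundary_angle f l) + f_up f l * sin (boundary_angle f l) = 0"
    and "f_down f l \<noteq> 0 \<or> f_up f l \<noteq> (0 :: real)"
proof -
  have "f_down f l * cos (boundary_angle f l) + f_up f l * sin (boundary_angle f l) = 0 \<and>
    (f_down f l \<noteq> 0 \<or> f_up f l \<noteq> 0)"
  proof (cases f)
    case Infty
    then show ?thesis by simp
  next
    case (Rational h0 h ps)
    have lead: "lead_factor h0 \<noteq> 0" by (simp add: lead_factor_def)
    define m where "m = pole_count f l"
    have sin_m: "sin (pi * real m) = 0" by (simp add: sin_npi2)
    show ?thesis
    proof (cases "l \<in> fst ` set ps")
      case True
      then obtain k where k: "k < length ps" "l = fst (ps ! k)" by (auto simp: pole_nth_iff)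
      have prod_0: "(\<Prod>i\<in>{..<length ps} - {j}. fst (ps ! i) - l) = 0" if "j \<noteq> k" for j
        using k that by (intro prod_zero) auto
      have "f_down f l = 0"
        using k by (auto simp: Rational)
      moreover have "sin (boundary_angle f l) = 0"
        using True sin_m by (simp add: Rational m_def del: pole_count.simps)
      moreover have "f_up f l \<noteq> 0"
      proof -
        have "(\<Sum>j<length ps. snd (ps ! j) * (\<Prod>i\<in>{..<length ps} - {j}. fst (ps ! i) - l))
            = snd (ps ! k) * (\<Prod>i\<in>{..<length ps} - {k}. fst (ps ! i) - l)"
          using k prod_0 by (subst sum.remove[of _ k]) (auto intro!: sum.neutral)
        moreover have "(\<Prod>i<length ps. fst (ps ! i) - l) = 0"
          using k by auto
        ultimately have "f_up f l = lead_factor h0 * (snd (ps ! k) * (\<Prod>i\<in>{..<length ps} - {k}. fst (ps ! i) - l))"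
          by (simp add: Rational)
        moreover have "(\<Prod>i\<in>{..<length ps} - {k}. fst (ps ! i) - l) \<noteq> 0"
          using k pole_nth_eq[OF assms[unfolded Rational]] by auto
        moreover have "snd (ps ! k) \<noteq> 0"
          using k assms Rational by force
        ultimately show ?thesis using lead by simp
      qed
      ultimately show ?thesis by simp
    next
      case False
      define v where "v = rational_val h0 h ps l"
      have down: "f_down f l \<noteq> 0"
        using False lead by (auto simp: Rational pole_nth_iff)
      have up: "f_up f l = v * f_down f l"
        unfolding Rational v_def using False by (intro f_up_eq) (auto simp: pole_nth_iff)
      have "boundary_angle f l = pi * real m + (pi / 2 + arctan v)"
        using False by (simp add: Rational m_def v_def del: pole_count.simps)
      then have "cos (boundary_angle f l) = - cos (pi * real m) * sin (arctan v)"
        "sin (boundary_angle f l) = cos (pi * real m) * cos (arctan v)"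
        by (simp_all add: cos_add sin_add sin_m)
      moreover have "sin (arctan v) = v * cos (arctan v)"
        by (simp add: sin_arctan cos_arctan)
      ultimately show ?thesis using down by (simp add: up)
    qed
  qed
  then show "f_down f l * cos (boundary_angle f l) + f_up f l * sin (boundary_angle f l) = 0"
    "f_down f l \<noteq> 0 \<or> f_up f l \<noteq> 0" by auto
qed

text \<open>If a pole is passed, the pole count rises and the bounds on the angle suffice. Otherwise
  each pole outside the interval has the same sign of \<open>h_k - l\<close> at both arguments, so
  every summand of \<open>f\<close> increases.\<close>

lemma boundary_angle_mono:
  assumes "in_R f" "l \<le> l'"
  shows "boundary_angle f l \<le> boundary_angle f l'"
proof (cases f)
  case (Rational h0 h ps)
  define S where "S x = {k. k < length ps \<and> fst (ps ! k) \<le> x}" for x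
  have count: "pole_count f x = card (S x)" for x by (simp add: Rational S_def)
  have sub: "S l \<subseteq> S l'" and fin: "finite (S l')"
    using assms by (auto simp: S_def)
  have "card (S l) \<le> card (S l')" by (rule card_mono[OF fin sub])
  then consider "card (S l) < card (S l')" | "S l = S l'"
    using card_subset_eq[OF fin sub] by linarith
  then show ?thesis
  proof cases
    case 1
    then have "pi * real (pole_count f l + 1) \<le> pi * real (pole_count f l')"
      by (intro mult_left_mono) (auto simp: count)
    then show ?thesis
      using boundary_angle_bounds[of f l] boundary_angle_bounds[of f l'] by linarith
  next
    case 2
    show ?thesis
    proof (cases "l \<in> fst ` set ps")
      case True
      then have "boundary_angle f l = pi * real (card (S l'))"
        by (simp add: Rational 2 count[unfolded Rational] del: pole_count.simps)
      then show ?thesis using boundary_angle_bounds(1)[of f l'] by (simp add: count)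
    next
      case False
      have side: "fst (ps ! k) < l \<or> l' < fst (ps ! k)" if "k < length ps" for k
      proof -
        have "l \<noteq> fst (ps ! k)" using False that by (auto simp: pole_nth_iff)
        moreover have "k \<in> S l \<longleftrightarrow> k \<in> S l'" using 2 by simp
        ultimately show ?thesis using that by (simp add: S_def) linarith
      qed
      have "rational_val h0 h ps l \<le> rational_val h0 h ps l'"
      proof -
        have "snd (ps ! k) / (fst (ps ! k) - l) \<le> snd (ps ! k) / (fst (ps ! k) - l')"
          if k: "k < length ps" for k
        proof -
          have "0 < snd (ps ! k)" using assms k by (simp add: Rational)
          moreover have "0 < (fst (ps ! k) - l) * (fst (ps ! k) - l')"
            using side[OF k] assms by (auto simp: zero_less_mult_iff)
          ultimately show ?thesis
            using assms by (intro divide_left_mono) auto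
        qed
        then show ?thesis
          using assms unfolding rational_val_def
          by (intro add_mono sum_mono mult_left_mono) (auto simp: Rational)
      qed
      then have "arctan (rational_val h0 h ps l) \<le> arctan (rational_val h0 h ps l')"
        by (simp add: arctan_le_iff)
      moreover have "l' \<notin> fst ` set ps"
      proof
        assume "l' \<in> fst ` set ps"
        then obtain k where "k < length ps" "l' = fst (ps ! k)" by (auto simp: pole_nth_iff)
        then show False using side[of k] assms by auto
      qed
      moreover have "pole_count f l = pole_count f l'" using 2 by (simp add: count)
      ultimately show ?thesis
        using False by (simp add: Rational del: pole_count.simps)
    qed
  qed
qed simp

section \<open>Continuity of the boundary angle\<close>

lemma eventually_at_right_poles:
  fixes l :: real
  assumes "finite P"
  shows "\<forall>\<^sub>F x in at_right l. \<forall>p\<in>P. p \<noteq> x \<and> (p \<le> x \<longleftrightarrow> p \<le> l)"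
proof (intro eventually_ball_finite assms ballI)
  fix p assume "p \<in> P"
  show "\<forall>\<^sub>F x in at_right l. p \<noteq> x \<and> (p \<le> x \<longleftrightarrow> p \<le> l)"
  proof (cases "p \<le> l")
    case True
    then show ?thesis by (intro eventually_at_rightI[of l "l + 1"]) auto
  next
    case False
    then show ?thesis by (intro eventually_at_rightI[of l p]) auto
  qed
qed

lemma eventually_at_left_poles:
  fixes l :: real
  assumes "finite P"
  shows "\<forall>\<^sub>F x in at_left l. \<forall>p\<in>P. p \<noteq> x \<and> (p \<le> x \<longleftrightarrow> p < l)"
proof (intro eventually_ball_finite assms ballI)
  fix p assume "p \<in> P"
  show "\<forall>\<^sub>F x in at_left l. p \<noteq> x \<and> (p \<le> x \<longleftrightarrow> p < l)"
  proof (cases "p < l")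
    case True
    then show ?thesis by (intro eventually_at_leftI[of p l]) auto
  next
    case False
    then show ?thesis by (intro eventually_at_leftI[of "l - 1" l]) auto
  qed
qed

text \<open>At a pole the jump of the count compensates that of the arctangent: from the left
  \<open>f\<close> tends to plus infinity and the arctangent to \<open>pi / 2\<close>, from the
  right \<open>f\<close> tends to minus infinity and the arctangent to \<open>- pi / 2\<close>,
  while the count has grown by one.\<close>

lemma isCont_boundary_angle:
  assumes "in_R f"
  shows "isCont (boundary_angle f) l"
proof (cases f)
  case Infty
  then have "boundary_angle f = (\<lambda>_. 0)" by auto
  then show ?thesis by simp
next
  case (Rational h0 h ps)
  define v :: "real \<Rightarrow> real" where "v = rational_val h0 h ps"
  define P where "P = fst ` set ps"
  have "finite P" by (simp add: P_def)
  have nth_P: "fst (ps ! k) \<in> P" if "k < length ps" for k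
    using that by (simp add: P_def)
  define m where "m = card {k. k < length ps \<and> fst (ps ! k) \<le> l}"
  define m' where "m' = card {k. k < length ps \<and> fst (ps ! k) < l}"
  have right: "\<forall>\<^sub>F x in at_right l. boundary_angle f x = pi * real m + (pi / 2 + arctan (v x))"
    using eventually_at_right_poles[OF \<open>finite P\<close>]
  proof eventually_elim
    case (elim x)
    then have "{k. k < length ps \<and> fst (ps ! k) \<le> x} = {k. k < length ps \<and> fst (ps ! k) \<le> l}"
      using nth_P by auto
    then show ?case using elim by (auto simp: Rational m_def v_def P_def)
  qed
  have left: "\<forall>\<^sub>F x in at_left l. boundary_angle f x = pi * real m' + (pi / 2 + arctan (v x))"
    using eventually_at_left_poles[OF \<open>finite P\<close>]
  proof eventually_elim
    case (elim x)
    then have "{k. k < length ps \<and> fst (ps ! k) \<le> x} = {k. k < length ps \<and> fst (ps ! k) < l}"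
      using nth_P by auto
    then show ?case using elim by (auto simp: Rational m'_def v_def P_def)
  qed
  have "((boundary_angle f) \<longlongrightarrow> boundary_angle f l) (at_right l) \<and>
    ((boundary_angle f) \<longlongrightarrow> boundary_angle f l) (at_left l)"
  proof (cases "l \<in> P")
    case False
    then have "fst (ps ! k) \<noteq> l" if "k < length ps" for k using nth_P[OF that] by auto
    then have v: "(v \<longlongrightarrow> v l) (at l)"
      unfolding v_def rational_val_def[abs_def] of_real_eq_id id_def by (intro tendsto_intros) auto
    have "{k. k < length ps \<and> fst (ps ! k) < l} = {k. k < length ps \<and> fst (ps ! k) \<le> l}"
      using False nth_P by (auto simp: less_le)
    then have "m' = m" by (simp add: m_def m'_def)
    have l: "boundary_angle f l = pi * real m + (pi / 2 + arctan (v l))"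
      using False by (simp add: Rational m_def v_def P_def)
    have "((\<lambda>x. pi * real m + (pi / 2 + arctan (v x))) \<longlongrightarrow> boundary_angle f l) (at l within S)" for S
      unfolding l using tendsto_within_subset[OF v, of S] by (intro tendsto_intros) auto
    then show ?thesis
      using right left by (simp add: tendsto_cong \<open>m' = m\<close>)
  next
    case True
    then obtain k where k: "k < length ps" "l = fst (ps ! k)" by (auto simp: P_def pole_nth_iff)
    define \<delta> where "\<delta> = snd (ps ! k)"
    have "0 < \<delta>" using k assms by (simp add: Rational \<delta>_def)
    \<comment> \<open>The part of \<open>f\<close> that stays finite at the pole
      \<open>l\<close>.\<close>
    define w where "w x = h0 * x + h + (\<Sum>j\<in>{..<length ps} - {k}. snd (ps ! j) / (fst (ps ! j) - x))" for x
    have v: "v x = w x + \<delta> / (l - x)" for x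
      using k by (simp add: v_def rational_val_def w_def \<delta>_def sum.remove[of "{..<length ps}" k])
    have w: "(w \<longlongrightarrow> w l) (at l within S)" for S
      unfolding w_def[abs_def] using pole_nth_eq[OF assms[unfolded Rational] _ k(1)] k(2)
      by (intro tendsto_intros) auto
    have "{k. k < length ps \<and> fst (ps ! k) \<le> l} = insert k {k. k < length ps \<and> fst (ps ! k) < l}"
      using k pole_nth_eq[OF assms[unfolded Rational] _ k(1)] by (auto simp: le_less)
    then have m: "m = Suc m'"
      using k by (simp add: m_def m'_def)
    have l: "boundary_angle f l = pi * real m"
      using True by (simp add: Rational m_def P_def)
    have "LIM x at_left l. \<delta> / (l - x) :> at_top"
    proof (rule LIM_at_top_divide)
      show "((\<lambda>x. l - x) \<longlongrightarrow> 0) (at_left l)"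
        by (auto intro!: tendsto_eq_intros)
      show "\<forall>\<^sub>F x in at_left l. 0 < l - x" by (intro eventually_at_leftI[of "l - 1"]) auto
    qed (use \<open>0 < \<delta>\<close> in auto)
    then have "filterlim v at_top (at_left l)"
      unfolding v[abs_def] by (rule filterlim_tendsto_add_at_top[OF w])
    then have "((\<lambda>x. arctan (v x)) \<longlongrightarrow> pi / 2) (at_left l)"
      by (rule filterlim_compose[OF tendsto_arctan_at_top])
    then have "((\<lambda>x. pi * real m' + (pi / 2 + arctan (v x))) \<longlongrightarrow> pi * real m' + (pi / 2 + pi / 2)) (at_left l)"
      by (intro tendsto_intros)
    then have L: "((\<lambda>x. pi * real m' + (pi / 2 + arctan (v x))) \<longlongrightarrow> boundary_angle f l) (at_left l)"
      by (simp add: l m distrib_left add.commute)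
    have "LIM x at_right l. \<delta> / (x - l) :> at_top"
    proof (rule LIM_at_top_divide)
      show "((\<lambda>x. x - l) \<longlongrightarrow> 0) (at_right l)"
        by (auto intro!: tendsto_eq_intros)
      show "\<forall>\<^sub>F x in at_right l. 0 < x - l" by (intro eventually_at_rightI[of _ "l + 1"]) auto
    qed (use \<open>0 < \<delta>\<close> in auto)
    then have "LIM x at_right l. - (\<delta> / (x - l)) :> at_bot"
      by (simp add: filterlim_uminus_at_bot)
    moreover have "- (\<delta> / (x - l)) = \<delta> / (l - x)" for x
      by (metis minus_diff_eq minus_divide_right)
    ultimately have "filterlim v at_bot (at_right l)"
      unfolding v[abs_def] by (simp add: filterlim_tendsto_add_at_bot_iff[OF w])
    then have "((\<lambda>x. arctan (v x)) \<longlongrightarrow> - (pi / 2)) (at_right l)"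
      by (rule filterlim_compose[OF tendsto_arctan_at_bot])
    then have "((\<lambda>x. pi * real m + (pi / 2 + arctan (v x))) \<longlongrightarrow> pi * real m + (pi / 2 + - (pi / 2))) (at_right l)"
      by (intro tendsto_intros)
    then have R: "((\<lambda>x. pi * real m + (pi / 2 + arctan (v x))) \<longlongrightarrow> boundary_angle f l) (at_right l)"
      by (simp add: l)
    show ?thesis using L R left right by (simp add: tendsto_cong)
  qed
  then show ?thesis
    by (simp add: isCont_def filterlim_split_at)
qed

lemma pole_count_eq_0:
  obtains l\<^sub>0 where "\<And>l. l \<le> l\<^sub>0 \<Longrightarrow> pole_count f l = 0"
proof (cases f)
  case (Rational h0 h ps)
  obtain b where b: "\<And>p. p \<in> fst ` set ps \<Longrightarrow> b \<le> p"
    using bdd_below_finite[of "fst ` set ps"] by (auto simp: bdd_below_def)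
  have "pole_count f l = 0" if "l \<le> b - 1" for l
  proof -
    have "\<not> fst (ps ! k) \<le> l" if "k < length ps" for k
      using b[of "fst (ps ! k)"] that \<open>l \<le> b - 1\<close> by force
    then show ?thesis by (auto simp: Rational)
  qed
  then show ?thesis by (rule that)
qed (use that in auto)

text \<open>Since \<open>y' = v + Q y\<close>, the condition at \<open>pi\<close> for the pair
  \<open>y\<close>, \<open>v\<close> is the one with \<open>F - Q pi\<close> in place of
  \<open>F\<close>. The poles are unchanged. At \<open>0\<close> there is no shift because
  \<open>Q 0 = 0\<close>.\<close>

fun add_const :: "real \<Rightarrow> rfun \<Rightarrow> rfun" where
  "add_const c Infty = Infty"
| "add_const c (Rational h0 h ps) = Rational h0 (h + c) ps"

lemma in_R_add_const: "in_R (add_const c f) = in_R f"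
  by (cases f) auto

lemma pole_count_add_const: "pole_count (add_const c f) l = pole_count f l"
  by (cases f) auto

lemma f_down_add_const: "f_down (add_const c f) z = f_down f z"
  by (cases f) auto

lemma f_up_add_const: "f_up (add_const c f) z = f_up f z + of_real c * f_down f z"
  by (cases f) (auto simp: algebra_simps)

section \<open>The Sturm-Liouville equation in polar coordinates\<close>

text \<open>Being orthogonal to the unit vector \<open>(c, s)\<close>, the pair
  \<open>(p, d)\<close> is a nonzero multiple of \<open>(s, - c)\<close>. Thus a boundary condition
  says that \<open>(u, v)\<close> is parallel to \<open>(s, c)\<close>.\<close>

lemma orthogonal_to_unit_vector:
  fixes p d s c :: real
  assumes "p * c + d * s = 0" "p \<noteq> 0 \<or> d \<noteq> 0" "s\<^sup>2 + c\<^sup>2 = 1"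
  shows "p * v + d * u = 0 \<longleftrightarrow> u * c = v * s"
proof -
  define k where "k = p * s - d * c"
  have "k * s = p * (s\<^sup>2 + c\<^sup>2) - c * (p * c + d * s)" "- (k * c) = d * (s\<^sup>2 + c\<^sup>2) - s * (p * c + d * s)"
    by (simp_all add: k_def algebra_simps power2_eq_square)
  then have p: "p = k * s" and d: "d = - (k * c)" by (simp_all add: assms)
  have "k \<noteq> 0" using p d assms(2) by auto
  moreover have "p * v + d * u = k * (v * s - u * c)" by (simp add: p d algebra_simps)
  ultimately show ?thesis by auto
qed

context prufer
begin

definition system_solution :: "real \<Rightarrow> (real \<Rightarrow> real) \<Rightarrow> (real \<Rightarrow> real) \<Rightarrow> bool" where
  "system_solution l u v \<longleftrightarrow> (\<forall>x\<in>{0..pi}.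
     (u has_real_derivative Q x * u x + v x) (at x within {0..pi}) \<and>
     (v has_real_derivative - (l + (Q x)\<^sup>2) * u x - Q x * v x) (at x within {0..pi}))"

text \<open>The integrand is the logarithmic derivative of the radius, obtained by inserting polar
  coordinates into the system; the radius is normalised to \<open>1\<close> at
  \<open>0\<close>.\<close>

definition radius :: "real \<Rightarrow> real \<Rightarrow> real \<Rightarrow> real" where
  "radius a l x = exp (integral {0..x} (\<lambda>t. Q t * ((sin (angle a l t))\<^sup>2 - (cos (angle a l t))\<^sup>2)
     + (1 - l - (Q t)\<^sup>2) * (sin (angle a l t) * cos (angle a l t))))"

lemma radius_pos: "0 < radius a l x"
  by (simp add: radius_def)

lemma radius_0: "radius a l 0 = 1"
  by (simp add: radius_def)

lemma system_solution_polar: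
  "system_solution l (\<lambda>x. radius a l x * sin (angle a l x)) (\<lambda>x. radius a l x * cos (angle a l x))"
  unfolding system_solution_def
proof
  fix x assume x: "x \<in> {0..pi}"
  define \<theta> where "\<theta> = angle a l"
  define k where "k t = Q t * ((sin (\<theta> t))\<^sup>2 - (cos (\<theta> t))\<^sup>2) + (1 - l - (Q t)\<^sup>2) * (sin (\<theta> t) * cos (\<theta> t))" for t
  have "continuous_on {0..pi} k"
    unfolding k_def \<theta>_def by (intro continuous_intros continuous_on_angle continuous_Q)
  then have "((\<lambda>x. integral {0..x} k) has_real_derivative k x) (at x within {0..pi})"
    by (rule integral_has_real_derivative[OF _ x])
  then have r: "(radius a l has_real_derivative radius a l x * k x) (at x within {0..pi})"
    unfolding radius_def[abs_def] \<theta>_def[symmetric] k_def[symmetric] by (auto intro!: derivative_eq_intros)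
  have \<theta>: "(\<theta> has_real_derivative G l x (\<theta> x)) (at x within {0..pi})"
    unfolding \<theta>_def by (rule angle_deriv[OF x])
  define s c where "s = sin (\<theta> x)" and "c = cos (\<theta> x)"
  have sc: "s\<^sup>2 + c\<^sup>2 = 1" by (simp add: s_def c_def)
  have e1: "k x * s + c * G l x (\<theta> x) = Q x * s + c"
  proof -
    \<comment> \<open>The factor \<open>s\<^sup>2 + c\<^sup>2\<close> makes both sides homogeneous
      of degree three in \<open>s\<close> and \<open>c\<close>, so the identity is purely
      polynomial.\<close>
    have "k x * s + c * G l x (\<theta> x) = (Q x * s + c) * (s\<^sup>2 + c\<^sup>2)"
      by (simp add: k_def G_def s_def[symmetric] c_def[symmetric] power2_eq_square algebra_simps)
    then show ?thesis by (simp add: sc)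
  qed
  have e2: "k x * c - s * G l x (\<theta> x) = - (l + (Q x)\<^sup>2) * s - Q x * c"
  proof -
    have "k x * c - s * G l x (\<theta> x) = (- (l + (Q x)\<^sup>2) * s - Q x * c) * (s\<^sup>2 + c\<^sup>2)"
      by (simp add: k_def G_def s_def[symmetric] c_def[symmetric] power2_eq_square algebra_simps)
    then show ?thesis by (simp add: sc)
  qed
  have "((\<lambda>x. radius a l x * sin (\<theta> x)) has_real_derivative radius a l x * (k x * s + c * G l x (\<theta> x))) (at x within {0..pi})"
    using r \<theta> by (auto intro!: derivative_eq_intros simp: s_def c_def algebra_simps)
  moreover have "((\<lambda>x. radius a l x * cos (\<theta> x)) has_real_derivative radius a l x * (k x * c - s * G l x (\<theta> x))) (at x within {0..pi})"
    using r \<theta> by (auto intro!: derivative_eq_intros simp: s_def c_def algebra_simps)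
  ultimately show "((\<lambda>x. radius a l x * sin (angle a l x)) has_real_derivative
      Q x * (radius a l x * sin (angle a l x)) + radius a l x * cos (angle a l x)) (at x within {0..pi}) \<and>
    ((\<lambda>x. radius a l x * cos (angle a l x)) has_real_derivative
      - (l + (Q x)\<^sup>2) * (radius a l x * sin (angle a l x)) - Q x * (radius a l x * cos (angle a l x)))
      (at x within {0..pi})"
    unfolding e1 e2 unfolding s_def c_def \<theta>_def by (simp add: algebra_simps)
qed

text \<open>The Wronskian is constant and vanishes at \<open>0\<close>, so the two solutions are
  parallel at every point; the proportionality factor then has derivative \<open>0\<close>.\<close>

lemma system_solution_proportional:
  assumes uv: "system_solution l u v" and UV: "system_solution l U V"
    and nz: "\<And>x. x \<in> {0..pi} \<Longrightarrow> (u x)\<^sup>2 + (v x)\<^sup>2 \<noteq> 0"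
    and 0: "U 0 * v 0 = V 0 * u 0"
  obtains c where "\<And>x. x \<in> {0..pi} \<Longrightarrow> U x = c * u x" "\<And>x. x \<in> {0..pi} \<Longrightarrow> V x = c * v x"
proof -
  note der = uv[unfolded system_solution_def, rule_format] UV[unfolded system_solution_def, rule_format]
  have "((\<lambda>x. U x * v x - V x * u x) has_real_derivative 0) (at x within {0..pi})"
    if x: "x \<in> {0..pi}" for x
    using der[OF x] by (auto intro!: derivative_eq_intros simp: algebra_simps power2_eq_square)
  then have "\<exists>w. \<forall>x\<in>{0..pi}. U x * v x - V x * u x = w"
    by (intro has_field_derivative_zero_constant) auto
  then obtain w where w: "\<And>x. x \<in> {0..pi} \<Longrightarrow> U x * v x - V x * u x = w" by blast
  from w[of 0] 0 have "w = 0" by simp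
  then have W: "U x * v x = V x * u x" if "x \<in> {0..pi}" for x using w[OF that] by simp
  define R where "R x = (u x)\<^sup>2 + (v x)\<^sup>2" for x
  \<comment> \<open>The coefficient of the projection of \<open>(U, V)\<close> on
    \<open>(u, v)\<close>, defined also where one of \<open>u\<close>, \<open>v\<close>
    vanishes.\<close>
  define c where "c x = (U x * u x + V x * v x) / R x" for x
  have U: "U x = c x * u x" and V: "V x = c x * v x" if "x \<in> {0..pi}" for x
  proof -
    have "R x \<noteq> 0" using nz[OF that] by (simp add: R_def)
    moreover have "U x * R x = (U x * u x + V x * v x) * u x"
      using W[OF that] by (simp add: R_def power2_eq_square algebra_simps)
    moreover have "V x * R x = (U x * u x + V x * v x) * v x"
      using W[OF that] by (simp add: R_def power2_eq_square algebra_simps)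
    ultimately show "U x = c x * u x" "V x = c x * v x" by (simp_all add: c_def field_simps)
  qed
  have "(c has_real_derivative 0) (at x within {0..pi})" if x: "x \<in> {0..pi}" for x
  proof -
    define N' where "N' = (Q x * U x + V x) * u x + U x * (Q x * u x + v x)
      + (- (l + (Q x)\<^sup>2) * U x - Q x * V x) * v x + V x * (- (l + (Q x)\<^sup>2) * u x - Q x * v x)"
    define R' where "R' = 2 * u x * (Q x * u x + v x) + 2 * v x * (- (l + (Q x)\<^sup>2) * u x - Q x * v x)"
    have N: "((\<lambda>x. U x * u x + V x * v x) has_real_derivative N') (at x within {0..pi})"
      using der[OF x] by (auto intro!: derivative_eq_intros simp: N'_def algebra_simps)
    have R: "(R has_real_derivative R') (at x within {0..pi})"
      unfolding R_def[abs_def] using der[OF x] by (auto intro!: derivative_eq_intros simp: R'_def algebra_simps)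
    have nzx: "R x \<noteq> 0" using nz[OF x] by (simp add: R_def)
    have "N' = c x * R'"
      by (simp add: N'_def R'_def U[OF x] V[OF x] algebra_simps)
    moreover have "U x * u x + V x * v x = c x * R x"
      using nzx by (simp add: c_def)
    ultimately have "N' * R x - (U x * u x + V x * v x) * R' = 0" by simp
    then show ?thesis
      unfolding c_def[abs_def] using DERIV_divide[OF N R nzx] by simp
  qed
  then have "\<exists>C. \<forall>x\<in>{0..pi}. c x = C"
    by (intro has_field_derivative_zero_constant) auto
  then obtain C where "\<And>x. x \<in> {0..pi} \<Longrightarrow> c x = C" by blast
  then show ?thesis using U V that by auto
qed

end

section \<open>Integrable potentials and equivalence with the first-order system\<close>

locale potential =
  fixes q :: "real \<Rightarrow> real"
  assumes integrable_q: "set_integrable lebesgue {0..pi} q"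
begin

definition Q :: "real \<Rightarrow> real" where "Q x = integral {0..x} q"

text \<open>Any bound of \<open>Q\<close> will do; fixing one as a constant of the locale supplies
  the second parameter of \<open>prufer\<close>.\<close>

definition M :: real where "M = (SOME M. \<forall>x\<in>{0..pi}. \<bar>Q x\<bar> \<le> M)"

lemma q_integrable_on: "q integrable_on {0..pi}"
  using integrable_q by (rule set_lebesgue_integral_eq_integral)

lemma continuous_on_Q: "continuous_on {0..pi} Q"
  unfolding Q_def[abs_def] by (rule indefinite_integral_continuous_1[OF q_integrable_on])

sublocale prufer Q M
proof
  obtain B where "\<forall>x\<in>{0..pi}. \<bar>Q x\<bar> \<le> B"
    using compact_imp_bounded[OF compact_continuous_image[OF continuous_on_Q]] by (fastforce simp: bounded_iff)
  then have "\<forall>x\<in>{0..pi}. \<bar>Q x\<bar> \<le> M"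
    unfolding M_def by (rule someI[where P = "\<lambda>M. \<forall>x\<in>{0..pi}. \<bar>Q x\<bar> \<le> M"])
  then show "\<And>x. x \<in> {0..pi} \<Longrightarrow> \<bar>Q x\<bar> \<le> M" by blast
qed (rule continuous_on_Q)

lemma Q_0: "Q 0 = 0"
  by (simp add: Q_def)

lemma absolutely_integrable_q_mult:
  assumes "continuous_on {0..pi} u"
  shows "(\<lambda>t. q t * u t) absolutely_integrable_on {0..pi}"
proof -
  have "(\<lambda>t. u t * q t) absolutely_integrable_on {0..pi}"
    using assms integrable_q compact_imp_bounded[OF compact_continuous_image[OF assms]]
    by (intro absolutely_integrable_bounded_measurable_product_real)
      (auto intro: continuous_imp_measurable_on_sets_lebesgue)
  then show ?thesis by (simp add: mult.commute)
qed

lemma integrable_on_initial: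
  assumes "continuous_on {0..pi} u" "x \<in> {0..pi}"
  shows "(\<lambda>t. q t * u t) integrable_on {0..x}" and "u integrable_on {0..x}"
proof -
  have sub: "{0..x} \<subseteq> {0..pi}" using assms(2) by auto
  show "(\<lambda>t. q t * u t) integrable_on {0..x}"
    by (rule integrable_on_subinterval[OF set_lebesgue_integral_eq_integral(1)[OF
          absolutely_integrable_q_mult[OF assms(1)]] sub])
  show "u integrable_on {0..x}"
    by (rule integrable_continuous_real[OF continuous_on_subset[OF assms(1) sub]])
qed

text \<open>Both terms are merely absolutely continuous, but the discontinuous part \<open>q u\<close> of their
  derivatives cancels: the increment of the first one is \<^term>\<open>u x\<close> times that of \<^term>\<open>Q\<close> up
  to an error of higher order.\<close>

lemma integral_q_mult_deriv:
  assumes u: "\<And>x. x \<in> {0..pi} \<Longrightarrow> (u has_real_derivative u' x) (at x within {0..pi})"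
    and a: "a \<in> {0..pi}"
  shows "((\<lambda>x. integral {0..x} (\<lambda>t. q t * u t) - Q x * u x) has_real_derivative - Q a * u' a)
    (at a within {0..pi})"
proof -
  have cont_u: "continuous_on {0..pi} u"
    by (rule DERIV_continuous_on) (rule u)
  have int_qu: "(\<lambda>t. q t * u t) integrable_on {0..pi}"
    using absolutely_integrable_q_mult[OF cont_u] by (rule set_lebesgue_integral_eq_integral)
  have int_abs: "(\<lambda>t. \<bar>q t\<bar>) integrable_on {0..pi}"
    using absolutely_integrable_norm[OF integrable_q] by (auto intro: set_lebesgue_integral_eq_integral simp: comp_def)
  define P where "P x = integral {0..x} (\<lambda>t. q t * u t)" for x
  define W where "W x = integral {0..x} (\<lambda>t. \<bar>q t\<bar>)" for x
  have cont_W: "continuous_on {0..pi} W"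
    unfolding W_def[abs_def] by (rule indefinite_integral_continuous_1[OF int_abs])
  have sub: "{x..y} \<subseteq> {0..pi}" if "x \<in> {0..pi}" "y \<in> {0..pi}" for x y :: real
    using that by auto
  have incr: "\<bar>P y - P x - (Q y - Q x) * u a\<bar> \<le> C * (W y - W x)"
    if xy: "x \<in> {0..pi}" "y \<in> {0..pi}" "x \<le> y"
      and C: "\<And>t. t \<in> {x..y} \<Longrightarrow> \<bar>u t - u a\<bar> \<le> C" for x y C
  proof -
    have comb: "integral {0..y} f - integral {0..x} f = integral {x..y} f"
      if "f integrable_on {0..pi}" for f :: "real \<Rightarrow> real"
    proof -
      have "f integrable_on {0..y}" by (rule integrable_on_subinterval[OF that sub]) (use xy in auto)
      from Henstock_Kurzweil_Integration.integral_combine[OF _ _ this, of x] show ?thesis using xy by auto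
    qed
    have P: "P y - P x = integral {x..y} (\<lambda>t. q t * u t)"
      unfolding P_def by (rule comb[OF int_qu])
    have Q: "Q y - Q x = integral {x..y} q"
      unfolding Q_def by (rule comb[OF q_integrable_on])
    have W: "W y - W x = integral {x..y} (\<lambda>t. \<bar>q t\<bar>)"
      unfolding W_def by (rule comb[OF int_abs])
    note int = integrable_on_subinterval[OF int_qu sub[OF xy(1,2)]]
      integrable_on_subinterval[OF q_integrable_on sub[OF xy(1,2)]]
      integrable_on_subinterval[OF int_abs sub[OF xy(1,2)]]
    have "P y - P x - (Q y - Q x) * u a = integral {x..y} (\<lambda>t. q t * u t - q t * u a)"
      unfolding P Q using int by (simp add: integral_diff integrable_on_mult_left)
    also have "norm \<dots> \<le> integral {x..y} (\<lambda>t. C * \<bar>q t\<bar>)"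
    proof (rule integral_norm_bound_integral)
      fix t assume "t \<in> {x..y}"
      have "norm (q t * u t - q t * u a) = \<bar>u t - u a\<bar> * \<bar>q t\<bar>"
        by (simp add: mult.commute flip: abs_mult right_diff_distrib)
      also have "\<dots> \<le> C * \<bar>q t\<bar>"
        using C[OF \<open>t \<in> {x..y}\<close>] by (intro mult_right_mono) auto
      finally show "norm (q t * u t - q t * u a) \<le> C * \<bar>q t\<bar>" .
    qed (use int in \<open>auto intro!: integrable_diff integrable_on_mult_left integrable_on_mult_right\<close>)
    finally show ?thesis unfolding W by simp
  qed
  have slope: "((\<lambda>x. (u x - u a) / (x - a)) \<longlongrightarrow> u' a) (at a within {0..pi})"
    using u[OF a] by (simp add: has_field_derivative_iff)
  \<comment> \<open>A bound for the difference quotients of \<open>u\<close> near \<open>a\<close>;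
    the added \<open>1\<close> makes the inequality strict.\<close>
  define C where "C = \<bar>u' a\<bar> + 1"
  have "\<forall>\<^sub>F x in at a within {0..pi}. \<bar>(u x - u a) / (x - a)\<bar> < C"
    by (rule order_tendstoD(2)[OF tendsto_rabs[OF slope]]) (simp add: C_def)
  then obtain \<delta> where "\<delta> > 0" and
    \<delta>: "\<And>x. x \<in> {0..pi} \<Longrightarrow> x \<noteq> a \<Longrightarrow> dist x a < \<delta> \<Longrightarrow> \<bar>(u x - u a) / (x - a)\<bar> < C"
    unfolding eventually_at by blast
  have lip: "\<bar>u x - u a\<bar> \<le> C * \<bar>x - a\<bar>" if "x \<in> {0..pi}" "\<bar>x - a\<bar> < \<delta>" for x
    using \<delta>[OF that(1)] that(2) by (cases "x = a") (auto simp: dist_real_def abs_divide field_simps)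
  \<comment> \<open>The numerator is at most \<open>C * \<bar>x - a\<bar>\<close> times the
    increment of \<open>W\<close>, and that increment tends to \<open>0\<close> by
    continuity.\<close>
  have "((\<lambda>x. (P x - P a - (Q x - Q a) * u a) / (x - a)) \<longlongrightarrow> 0) (at a within {0..pi})"
  proof (rule Lim_null_comparison)
    have "(W \<longlongrightarrow> W a) (at a within {0..pi})"
      using cont_W a by (simp add: continuous_on_def)
    then have "((\<lambda>x. C * \<bar>W x - W a\<bar>) \<longlongrightarrow> C * \<bar>W a - W a\<bar>) (at a within {0..pi})"
      by (intro tendsto_intros)
    then show "((\<lambda>x. C * \<bar>W x - W a\<bar>) \<longlongrightarrow> 0) (at a within {0..pi})" by simp
    show "\<forall>\<^sub>F x in at a within {0..pi}. norm ((P x - P a - (Q x - Q a) * u a) / (x - a)) \<le> C * \<bar>W x - W a\<bar>"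
      unfolding eventually_at
    proof (intro exI[of _ \<delta>] conjI ballI impI \<open>\<delta> > 0\<close>)
      fix x assume x: "x \<in> {0..pi}" and "x \<noteq> a \<and> dist x a < \<delta>"
      then have xa: "x \<noteq> a" "\<bar>x - a\<bar> < \<delta>" by (auto simp: dist_real_def)
      have C: "\<bar>u t - u a\<bar> \<le> C * \<bar>x - a\<bar>" if t: "t \<in> {min a x..max a x}" for t
      proof -
        have "t \<in> {0..pi}" "\<bar>t - a\<bar> \<le> \<bar>x - a\<bar>"
          using x a t by (auto simp: min_def max_def split: if_splits)
        then show ?thesis
          using lip[of t] xa mult_left_mono[of "\<bar>t - a\<bar>" "\<bar>x - a\<bar>" C] by (simp add: C_def)
      qed
      have "\<bar>P x - P a - (Q x - Q a) * u a\<bar> \<le> C * \<bar>x - a\<bar> * \<bar>W x - W a\<bar>"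
      proof (cases "a \<le> x")
        case True
        then have "\<bar>P x - P a - (Q x - Q a) * u a\<bar> \<le> C * \<bar>x - a\<bar> * (W x - W a)"
          using incr[of a x "C * \<bar>x - a\<bar>"] C a x by (simp add: min_def max_def)
        also have "\<dots> \<le> C * \<bar>x - a\<bar> * \<bar>W x - W a\<bar>"
          by (intro mult_left_mono) (auto simp: C_def)
        finally show ?thesis .
      next
        case False
        then have "\<bar>P a - P x - (Q a - Q x) * u a\<bar> \<le> C * \<bar>x - a\<bar> * (W a - W x)"
          using incr[of x a "C * \<bar>x - a\<bar>"] C a x by (simp add: min_def max_def)
        also have "\<dots> \<le> C * \<bar>x - a\<bar> * \<bar>W x - W a\<bar>"
          by (intro mult_left_mono) (auto simp: C_def)
        also have "P a - P x - (Q a - Q x) * u a = - (P x - P a - (Q x - Q a) * u a)"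
          by (simp add: algebra_simps)
        finally show ?thesis by simp
      qed
      then show "norm ((P x - P a - (Q x - Q a) * u a) / (x - a)) \<le> C * \<bar>W x - W a\<bar>"
        using xa by (simp add: abs_divide divide_le_eq mult_ac)
    qed
  qed
  moreover have "((\<lambda>x. Q x * ((u x - u a) / (x - a))) \<longlongrightarrow> Q a * u' a) (at a within {0..pi})"
    using continuous_on_Q a slope by (intro tendsto_mult) (auto simp: continuous_on_def)
  ultimately have "((\<lambda>x. (P x - P a - (Q x - Q a) * u a) / (x - a) - Q x * ((u x - u a) / (x - a)))
      \<longlongrightarrow> 0 - Q a * u' a) (at a within {0..pi})"
    by (rule tendsto_diff)
  moreover have "(P x - P a - (Q x - Q a) * u a) / (x - a) - Q x * ((u x - u a) / (x - a))
      = ((P x - Q x * u x) - (P a - Q a * u a)) / (x - a)" for x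
    by (simp add: algebra_simps flip: diff_divide_distrib)
  ultimately show ?thesis
    unfolding has_field_derivative_iff P_def[symmetric] by simp
qed

text \<open>The functional \<open>h\<close> stands for the real or imaginary part. Integrating the
  equation expresses \<open>h (y' x)\<close> through the integral of \<open>q u\<close>; subtracting
  \<open>Q u\<close> leaves a differentiable function by
  \<open>integral_q_mult_deriv\<close>.\<close>

lemma SL_solution_imp_system_solution:
  assumes y: "SL_solution q (of_real l) y y'"
    and h: "bounded_linear (h :: complex \<Rightarrow> real)" "\<And>r z. h (of_real r * z) = r * h z"
  shows "system_solution l (\<lambda>x. h (y x)) (\<lambda>x. h (y' x) - Q x * h (y x))"
proof -
  define u where "u x = h (y x)" for x
  define w where "w x = h (y' x)" for x
  have u: "(u has_real_derivative w x) (at x within {0..pi})" if "x \<in> {0..pi}" for x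
    using y that bounded_linear.has_vector_derivative[OF h(1)]
    unfolding SL_solution_def u_def[abs_def] w_def has_real_derivative_iff_has_vector_derivative by blast
  have cont_u: "continuous_on {0..pi} u"
    by (rule DERIV_continuous_on) (rule u)
  obtain g where g: "set_integrable lebesgue {0..pi} g"
    "\<And>x. x \<in> {0..pi} \<Longrightarrow> y' x = y' 0 + (LINT t:{0..x}|lebesgue. g t)"
    and ae: "AE x in lebesgue. x \<in> {0<..<pi} \<longrightarrow> - g x + of_real (q x) * y x = of_real l * y x"
    using y unfolding SL_solution_def AC_deriv_def by blast
  obtain N where N: "negligible N"
    "\<And>x. x \<notin> N \<Longrightarrow> x \<in> {0<..<pi} \<Longrightarrow> - g x + of_real (q x) * y x = of_real l * y x"
    using ae unfolding eventually_ae_filter_negligible by blast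
  \<comment> \<open>The equation holds almost everywhere in the open interval only, so the end
    points join the exceptional set.\<close>
  have "negligible (N \<union> {0, pi})" using N(1) by simp
  have w: "w x = w 0 + (integral {0..x} (\<lambda>t. q t * u t) - l * integral {0..x} u)" if x: "x \<in> {0..pi}" for x
  proof -
    have gx: "set_integrable lebesgue {0..x} g"
      using x by (intro set_integrable_subset[OF g(1)]) auto
    have "w x = w 0 + h (integral {0..x} g)"
      using g(2)[OF x] h(1)
      by (simp add: w_def linear_add[OF bounded_linear.linear] set_lebesgue_integral_eq_integral(2)[OF gx])
    also have "h (integral {0..x} g) = integral {0..x} (h \<circ> g)"
      by (rule integral_linear[OF _ h(1), symmetric]) (rule set_lebesgue_integral_eq_integral(1)[OF gx])
    also have "\<dots> = integral {0..x} (\<lambda>t. q t * u t - l * u t)"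
    proof (rule integral_spike[OF \<open>negligible (N \<union> {0, pi})\<close>])
      fix t assume "t \<in> {0..x} - (N \<union> {0, pi})"
      then have "t \<notin> N" "t \<in> {0<..<pi}" using x by auto
      from N(2)[OF this] have "g t = of_real (q t) * y t + of_real (- l) * y t"
        by (simp add: algebra_simps)
      then show "q t * u t - l * u t = (h \<circ> g) t"
        using h by (simp only: linear_add[OF bounded_linear.linear] comp_apply h(2) u_def)
    qed
    also have "\<dots> = integral {0..x} (\<lambda>t. q t * u t) - l * integral {0..x} u"
      using integrable_on_initial[OF cont_u x] by (simp add: integral_diff integrable_on_mult_right)
    finally show ?thesis .
  qed
  have "((\<lambda>x. w x - Q x * u x) has_real_derivative - Q x * w x - l * u x) (at x within {0..pi})"
    if x: "x \<in> {0..pi}" for x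
  proof -
    have "((\<lambda>x. w 0 + ((integral {0..x} (\<lambda>t. q t * u t) - Q x * u x) - l * integral {0..x} u))
      has_real_derivative 0 + (- Q x * w x - l * u x)) (at x within {0..pi})"
      using integral_q_mult_deriv[OF u x] integral_has_real_derivative[OF cont_u x]
      by (intro DERIV_add DERIV_diff DERIV_cmult DERIV_const)
    then have "((\<lambda>x. w 0 + ((integral {0..x} (\<lambda>t. q t * u t) - Q x * u x) - l * integral {0..x} u))
      has_real_derivative - Q x * w x - l * u x) (at x within {0..pi})" by simp
    then show ?thesis
    proof (rule has_field_derivative_transform_within[where d = 1])
      fix z assume "z \<in> {0..pi}"
      from w[OF this] show "w 0 + ((integral {0..z} (\<lambda>t. q t * u t) - Q z * u z) - l * integral {0..z} u) = w z - Q z * u z"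
        by simp
    qed (use x in auto)
  qed
  moreover have "- Q x * w x - l * u x = - (l + (Q x)\<^sup>2) * u x - Q x * (w x - Q x * u x)" for x
    by (simp add: algebra_simps power2_eq_square)
  ultimately show ?thesis
    unfolding system_solution_def u_def[symmetric] w_def[symmetric] using u by simp
qed

text \<open>The density of the second derivative must be \<open>q u - l u\<close>. Its integral
  differs from \<open>v + Q u\<close> by a constant, because the difference has derivative
  \<open>0\<close> once the terms with \<open>q\<close> cancel.\<close>

lemma system_solution_imp_SL_solution:
  assumes "system_solution l u v"
  shows "SL_solution q (of_real l) (\<lambda>x. of_real (u x)) (\<lambda>x. of_real (v x + Q x * u x))"
proof -
  have u: "(u has_real_derivative v x + Q x * u x) (at x within {0..pi})"
    and v: "(v has_real_derivative - (l + (Q x)\<^sup>2) * u x - Q x * v x) (at x within {0..pi})"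
    if "x \<in> {0..pi}" for x
    using assms that by (auto simp: system_solution_def add.commute)
  have cont_u: "continuous_on {0..pi} u"
    by (rule DERIV_continuous_on) (rule u)
  define w where "w x = v x + Q x * u x" for x
  define g where "g t = q t * u t - l * u t" for t
  have "g absolutely_integrable_on {0..pi}"
    unfolding g_def
    by (intro set_integral_diff absolutely_integrable_q_mult cont_u)
      (auto intro!: absolutely_integrable_continuous_real continuous_intros cont_u)
  then have "(complex_of_real \<circ> g) absolutely_integrable_on {0..pi}"
    by (rule absolutely_integrable_linear[OF _ bounded_linear_of_real])
  then have g: "(\<lambda>t. complex_of_real (g t)) absolutely_integrable_on {0..pi}"
    by (simp add: comp_def)
  have "((\<lambda>x. w x - integral {0..x} g) has_real_derivative 0) (at x within {0..pi})"
    if x: "x \<in> {0..pi}" for x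
  proof -
    have "((\<lambda>x. v x - (integral {0..x} (\<lambda>t. q t * u t) - Q x * u x) + l * integral {0..x} u)
      has_real_derivative (- (l + (Q x)\<^sup>2) * u x - Q x * v x) - (- Q x * (v x + Q x * u x)) + l * u x) (at x within {0..pi})"
      using integral_q_mult_deriv[OF u x] integral_has_real_derivative[OF cont_u x] v[OF x]
      by (intro DERIV_add DERIV_diff DERIV_cmult DERIV_const)
    then have "((\<lambda>x. v x - (integral {0..x} (\<lambda>t. q t * u t) - Q x * u x) + l * integral {0..x} u)
      has_real_derivative 0) (at x within {0..pi})"
      by (simp add: algebra_simps power2_eq_square)
    then show ?thesis
    proof (rule has_field_derivative_transform_within[where d = 1])
      fix z assume z: "z \<in> {0..pi}"
      then show "v z - (integral {0..z} (\<lambda>t. q t * u t) - Q z * u z) + l * integral {0..z} u = w z - integral {0..z} g"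
        unfolding g_def w_def using integrable_on_initial[OF cont_u]
        by (simp add: integral_diff integrable_on_mult_right)
    qed (use x in auto)
  qed
  then have "\<exists>c. \<forall>x\<in>{0..pi}. w x - integral {0..x} g = c"
    by (intro has_field_derivative_zero_constant) auto
  then obtain c where c: "\<And>x. x \<in> {0..pi} \<Longrightarrow> w x - integral {0..x} g = c" by blast
  have w: "w x = w 0 + integral {0..x} g" if "x \<in> {0..pi}" for x
    using c[OF that] c[of 0] by simp
  have "AC_deriv (\<lambda>x. complex_of_real (w x)) (\<lambda>t. of_real (g t))"
    unfolding AC_deriv_def
  proof (intro conjI ballI g)
    fix x assume x: "x \<in> {0..pi}"
    have gx: "set_integrable lebesgue {0..x} (\<lambda>t. complex_of_real (g t))"
      using x by (intro set_integrable_subset[OF g]) auto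
    have "g integrable_on {0..x}"
      by (rule integrable_on_subinterval[OF set_lebesgue_integral_eq_integral(1)[OF \<open>g absolutely_integrable_on {0..pi}\<close>]])
        (use x in auto)
    then have "integral {0..x} (\<lambda>t. complex_of_real (g t)) = of_real (integral {0..x} g)"
      using integral_linear[OF _ bounded_linear_of_real, of g] by (auto simp: comp_def)
    then show "complex_of_real (w x) = of_real (w 0) + (LINT t:{0..x}|lebesgue. complex_of_real (g t))"
      using w[OF x] by (simp add: set_lebesgue_integral_eq_integral(2)[OF gx])
  qed
  moreover have "((\<lambda>x. complex_of_real (u x)) has_vector_derivative of_real (w x)) (at x within {0..pi})"
    if "x \<in> {0..pi}" for x
    using u[OF that] unfolding w_def has_real_derivative_iff_has_vector_derivative
    by (rule bounded_linear.has_vector_derivative[OF bounded_linear_of_real])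
  ultimately show ?thesis
    unfolding SL_solution_def w_def[symmetric]
    by (intro conjI ballI exI[of _ "\<lambda>t. of_real (g t)"]) (auto simp: g_def algebra_simps)
qed

section \<open>Boundary conditions and eigenvalues in terms of angles\<close>

definition total_angle :: "rfun \<Rightarrow> rfun \<Rightarrow> real \<Rightarrow> real" where
  "total_angle f F l = angle (boundary_angle f l) l pi + boundary_angle (add_const (- Q pi) F) l"

text \<open>The sign of \<open>f_up\<close> at \<open>pi\<close> is opposite to that at
  \<open>0\<close>, so the prescribed direction is reflected: the angle must equal minus the
  boundary angle modulo \<pi>. This is why the two angles are added in
  \<open>total_angle\<close>.\<close>

lemma right_condition_iff:
  assumes "in_R F"
  shows "f_down F l * (cos t + Q pi * sin t) - f_up F l * sin t = 0
    \<longleftrightarrow> sin (t + boundary_angle (add_const (- Q pi) F) l) = 0"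
proof -
  let ?F = "add_const (- Q pi) F"
  have F: "in_R ?F" using assms by (simp add: in_R_add_const)
  have "f_down F l * (cos t + Q pi * sin t) - f_up F l * sin t
      = f_down ?F l * cos t + f_up ?F l * (- sin t)"
    by (simp add: f_down_add_const f_up_add_const algebra_simps)
  also have "\<dots> = 0 \<longleftrightarrow> - sin t * cos (boundary_angle ?F l) = cos t * sin (boundary_angle ?F l)"
    by (rule orthogonal_to_unit_vector[OF boundary_angle_condition[OF F]]) simp
  finally show ?thesis by (auto simp: sin_add)
qed

lemma eigenvalue_if_total_angle:
  assumes "in_R f" "in_R F" "sin (total_angle f F l) = 0"
  shows "of_real l \<in> eigenvalues q f F"
proof -
  define \<theta> where "\<theta> = angle (boundary_angle f l) l"
  define r where "r = radius (boundary_angle f l) l"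
  define u v where "u x = r x * sin (\<theta> x)" and "v x = r x * cos (\<theta> x)" for x
  have sol: "system_solution l u v"
    unfolding u_def[abs_def] v_def[abs_def] r_def \<theta>_def by (rule system_solution_polar)
  obtain x where x: "x \<in> {0<..<pi}" "sin (\<theta> x) \<noteq> 0"
    using sin_angle_neq_0 unfolding \<theta>_def by blast
  have "u x \<noteq> 0"
    using x(2) radius_pos[of "boundary_angle f l" l x] by (simp add: u_def r_def)
  then have "\<exists>x\<in>{0..pi}. complex_of_real (u x) \<noteq> 0"
    using x(1) by (intro bexI[of _ x]) auto
  moreover have "f_down f l * (v 0 + Q 0 * u 0) + f_up f l * u 0 = 0"
    using boundary_angle_condition(1)[OF assms(1), of l]
    by (simp add: u_def v_def r_def \<theta>_def radius_0 angle_0 Q_0)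
  moreover have "f_down F l * (v pi + Q pi * u pi) - f_up F l * u pi = 0"
  proof -
    have "f_down F l * (cos (\<theta> pi) + Q pi * sin (\<theta> pi)) - f_up F l * sin (\<theta> pi) = 0"
      unfolding right_condition_iff[OF assms(2)] using assms(3) by (simp add: total_angle_def \<theta>_def)
    then have "r pi * (f_down F l * (cos (\<theta> pi) + Q pi * sin (\<theta> pi)) - f_up F l * sin (\<theta> pi)) = 0"
      by simp
    then show ?thesis by (simp add: u_def v_def algebra_simps)
  qed
  ultimately have "(\<exists>x\<in>{0..pi}. complex_of_real (u x) \<noteq> 0) \<and>
    complex_of_real (f_down f l * (v 0 + Q 0 * u 0) + f_up f l * u 0) = 0 \<and>
    complex_of_real (f_down F l * (v pi + Q pi * u pi) - f_up F l * u pi) = 0"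
    by (simp only: of_real_0 simp_thms)
  then have "eigenfunction q f F (of_real l) (\<lambda>x. of_real (u x))"
    unfolding eigenfunction_def f_down_of_real f_up_of_real of_real_add of_real_mult of_real_diff
    using system_solution_imp_SL_solution[OF sol, unfolded of_real_add of_real_mult] by blast
  then show ?thesis by (auto simp: eigenvalues_def)
qed

text \<open>By the condition at \<open>0\<close>, the real and imaginary parts of an eigenfunction
  are both multiples of the polar solution started at the boundary angle of \<open>f\<close>. Hence
  \<open>y\<close> is a nonzero complex multiple of it, with the same zeros and the same condition
  at \<open>pi\<close>.\<close>

lemma eigenfunction_angle:
  assumes "in_R f" "in_R F" "eigenfunction q f F (of_real l) y"
  shows "sin (total_angle f F l) = 0"
    and "x \<in> {0..pi} \<Longrightarrow> y x = 0 \<longleftrightarrow> sin (angle (boundary_angle f l) l x) = 0"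
proof -
  define a where "a = boundary_angle f l"
  define \<theta> where "\<theta> = angle a l"
  define r where "r = radius a l"
  define u v where "u x = r x * sin (\<theta> x)" and "v x = r x * cos (\<theta> x)" for x
  have sol: "system_solution l u v"
    unfolding u_def[abs_def] v_def[abs_def] r_def \<theta>_def by (rule system_solution_polar)
  have r: "r x > 0" for x by (simp add: r_def radius_pos)
  have nz: "(u x)\<^sup>2 + (v x)\<^sup>2 \<noteq> 0" for x
  proof -
    have "(u x)\<^sup>2 + (v x)\<^sup>2 = (r x)\<^sup>2 * ((sin (\<theta> x))\<^sup>2 + (cos (\<theta> x))\<^sup>2)"
      unfolding u_def v_def by (simp only: power_mult_distrib distrib_left)
    then show ?thesis using r[of x] by simp
  qed
  obtain y' where y': "SL_solution q (of_real l) y y'"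
    and left: "f_down f (of_real l) * y' 0 + f_up f (of_real l) * y 0 = 0"
    and right: "f_down F (of_real l) * y' pi - f_up F (of_real l) * y pi = 0"
    and "\<exists>x\<in>{0..pi}. y x \<noteq> 0"
    using assms(3) unfolding eigenfunction_def by blast
  have proportional: "\<exists>c. \<forall>x\<in>{0..pi}. h (y x) = c * u x \<and> h (y' x) - Q x * h (y x) = c * v x"
    if h: "bounded_linear h" "\<And>r z. h (of_real r * z) = r * h z" for h :: "complex \<Rightarrow> real"
  proof -
    have "f_down f l * h (y' 0) + f_up f l * h (y 0) = 0"
      using arg_cong[OF left, of h] h
      by (simp add: f_down_of_real f_up_of_real linear_add[OF bounded_linear.linear] linear_0[OF bounded_linear.linear])
    then have "h (y 0) * cos a = h (y' 0) * sin a"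
      unfolding a_def
      by (subst (asm) orthogonal_to_unit_vector[OF boundary_angle_condition[OF assms(1)]]) auto
    then have "h (y 0) * v 0 = (h (y' 0) - Q 0 * h (y 0)) * u 0"
      by (simp add: u_def v_def r_def \<theta>_def radius_0 angle_0 Q_0)
    then obtain c where "\<And>x. x \<in> {0..pi} \<Longrightarrow> h (y x) = c * u x"
      "\<And>x. x \<in> {0..pi} \<Longrightarrow> h (y' x) - Q x * h (y x) = c * v x"
      by (rule system_solution_proportional[OF sol SL_solution_imp_system_solution[OF y' h] nz]) blast
    then show ?thesis by blast
  qed
  have "\<exists>c. \<forall>x\<in>{0..pi}. Re (y x) = c * u x \<and> Re (y' x) - Q x * Re (y x) = c * v x"
    by (rule proportional[OF bounded_linear_Re]) simp
  then obtain c1 where c1: "\<And>x. x \<in> {0..pi} \<Longrightarrow> Re (y x) = c1 * u x"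
    "\<And>x. x \<in> {0..pi} \<Longrightarrow> Re (y' x) - Q x * Re (y x) = c1 * v x"
    by blast
  have "\<exists>c. \<forall>x\<in>{0..pi}. Im (y x) = c * u x \<and> Im (y' x) - Q x * Im (y x) = c * v x"
    by (rule proportional[OF bounded_linear_Im]) simp
  then obtain c2 where c2: "\<And>x. x \<in> {0..pi} \<Longrightarrow> Im (y x) = c2 * u x"
    "\<And>x. x \<in> {0..pi} \<Longrightarrow> Im (y' x) - Q x * Im (y x) = c2 * v x"
    by blast
  define c where "c = Complex c1 c2"
  have y: "y x = c * of_real (u x)" if "x \<in> {0..pi}" for x
    using c1(1)[OF that] c2(1)[OF that] by (simp add: c_def complex_eq_iff)
  have y'': "y' x = c * of_real (v x + Q x * u x)" if "x \<in> {0..pi}" for x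
    using c1[OF that] c2[OF that] by (simp add: c_def complex_eq_iff algebra_simps)
  have "c \<noteq> 0" using \<open>\<exists>x\<in>{0..pi}. y x \<noteq> 0\<close> y by auto
  then show "x \<in> {0..pi} \<Longrightarrow> y x = 0 \<longleftrightarrow> sin (angle (boundary_angle f l) l x) = 0"
    using y[of x] r[of x] by (simp add: u_def \<theta>_def a_def)
  have "c * of_real (f_down F l * (v pi + Q pi * u pi) - f_up F l * u pi) = 0"
    using right by (simp add: y y'' f_down_of_real f_up_of_real algebra_simps)
  then have "f_down F l * (v pi + Q pi * u pi) - f_up F l * u pi = 0"
    using \<open>c \<noteq> 0\<close> by (simp del: of_real_diff of_real_mult of_real_add)
  then have "r pi * (f_down F l * (cos (\<theta> pi) + Q pi * sin (\<theta> pi)) - f_up F l * sin (\<theta> pi)) = 0"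
    by (simp add: u_def v_def algebra_simps)
  then have "f_down F l * (cos (\<theta> pi) + Q pi * sin (\<theta> pi)) - f_up F l * sin (\<theta> pi) = 0"
    using r[of pi] by simp
  then show "sin (total_angle f F l) = 0"
    unfolding right_condition_iff[OF assms(2)] by (simp add: total_angle_def \<theta>_def a_def)
qed

section \<open>Counting eigenvalues and zeros\<close>

lemma total_angle_strict_mono:
  assumes "in_R f" "in_R F"
  shows "strict_mono (total_angle f F)"
proof (rule strict_monoI)
  fix l l' :: real assume "l < l'"
  then have "angle (boundary_angle f l) l pi < angle (boundary_angle f l') l' pi"
    by (intro angle_strict_mono boundary_angle_mono assms) auto
  moreover have "boundary_angle (add_const (- Q pi) F) l \<le> boundary_angle (add_const (- Q pi) F) l'"
    using \<open>l < l'\<close> assms(2) by (intro boundary_angle_mono) (auto simp: in_R_add_const)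
  ultimately show "total_angle f F l < total_angle f F l'"
    unfolding total_angle_def by linarith
qed

lemma isCont_total_angle:
  assumes "in_R f" "in_R F"
  shows "isCont (total_angle f F) l"
proof -
  define C where "C = (1 + pi) * exp (Lip l * pi)"
  \<comment> \<open>Initial angle and spectral parameter vary together, so
    \<open>angle_diff_le\<close> is applied with the larger of the two deviations.\<close>
  define \<eta> where "\<eta> x = max \<bar>boundary_angle f x - boundary_angle f l\<bar> \<bar>x - l\<bar>" for x
  have "isCont (\<lambda>x. \<eta> x * C) l"
    unfolding \<eta>_def by (intro continuous_intros isCont_boundary_angle assms)
  then have lim: "((\<lambda>x. \<eta> x * C) \<longlongrightarrow> 0) (at l)"
    unfolding isCont_def by (simp add: \<eta>_def)
  have "((\<lambda>x. angle (boundary_angle f x) x pi - angle (boundary_angle f l) l pi) \<longlongrightarrow> 0) (at l)"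
    by (rule Lim_null_comparison[OF _ lim], rule always_eventually)
      (auto simp: C_def \<eta>_def intro!: angle_diff_le)
  then have "isCont (\<lambda>x. angle (boundary_angle f x) x pi) l"
    unfolding isCont_def by (subst LIM_zero_iff[symmetric])
  then show ?thesis
    unfolding total_angle_def[abs_def] using assms
    by (intro continuous_intros isCont_boundary_angle) (simp_all add: in_R_add_const)
qed

lemma angle_pi_gt: "pi * real (pole_count f l) < angle (boundary_angle f l) l pi"
  using boundary_angle_bounds(1)[of f l]
  by (intro angle_crossing[where x\<^sub>0 = 0]) (auto simp: angle_0)

text \<open>In particular the total angle is positive, so the multiples of \<pi> that it attains
  start with \<pi> itself.\<close>

lemma total_angle_gt: "pi * real (pole_count f l + pole_count F l) < total_angle f F l"
  using angle_pi_gt[of f l] boundary_angle_bounds(1)[of "add_const (- Q pi) F" l]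
  by (simp add: total_angle_def pole_count_add_const distrib_left)

lemma total_angle_lt_pi:
  assumes "in_R f" "in_R F"
  obtains l\<^sub>0 where "\<And>l. l \<le> l\<^sub>0 \<Longrightarrow> total_angle f F l < pi"
proof -
  let ?F = "add_const (- Q pi) F"
  obtain l\<^sub>1 where l\<^sub>1: "\<And>l. l \<le> l\<^sub>1 \<Longrightarrow> pole_count f l = 0" by (rule pole_count_eq_0) blast
  obtain l\<^sub>2 where l\<^sub>2: "\<And>l. l \<le> l\<^sub>2 \<Longrightarrow> pole_count ?F l = 0" by (rule pole_count_eq_0) blast
  define m where "m = min l\<^sub>1 l\<^sub>2"
  define b where "b = boundary_angle ?F m"
  have b: "0 \<le> b" "b < pi"
    using boundary_angle_bounds[of ?F m] l\<^sub>2[of m] by (auto simp: b_def m_def)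
  have a: "boundary_angle f m < pi"
    using boundary_angle_bounds[of f m] l\<^sub>1[of m] by (auto simp: m_def)
  \<comment> \<open>Half of the room that \<open>b\<close> leaves below \<pi>, so that
    \<open>\<epsilon> + b < pi\<close>.\<close>
  define \<epsilon> where "\<epsilon> = (pi - b) / 2"
  define c where "c = max \<epsilon> (boundary_angle f m)"
  obtain l\<^sub>3 where l\<^sub>3: "\<And>l a. l \<le> l\<^sub>3 \<Longrightarrow> a \<le> c \<Longrightarrow> angle a l pi \<le> \<epsilon>"
  proof (rule angle_small)
    show "0 < \<epsilon>" "\<epsilon> \<le> c" "c < pi"
      using a b by (auto simp: \<epsilon>_def c_def)
  qed blast
  show ?thesis
  proof (rule that[of "min m l\<^sub>3"])
    fix l assume l: "l \<le> min m l\<^sub>3"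
    have "boundary_angle f l \<le> c"
      using boundary_angle_mono[OF assms(1), of l m] l by (auto simp: c_def)
    then have "angle (boundary_angle f l) l pi \<le> \<epsilon>"
      using l by (intro l\<^sub>3) auto
    moreover have "boundary_angle ?F l \<le> b"
      using boundary_angle_mono[of ?F l m] l assms(2) by (simp add: b_def in_R_add_const)
    ultimately show "total_angle f F l < pi"
      using b(2) by (simp add: total_angle_def \<epsilon>_def field_simps)
  qed
qed

text \<open>The total angle maps these values bijectively onto the multiples \<open>pi * k\<close>
  with \<open>1 \<le> k < N\<close>: it is positive, strictly increasing and continuous, and falls
  below \<pi> far to the left, so all of them are attained.\<close>

lemma card_eigenvalues_below:
  assumes "in_R f" "in_R F" "total_angle f F l = pi * real N"
  shows "card {m. m < l \<and> sin (total_angle f F m) = 0} = N - 1"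
proof -
  let ?\<Theta> = "total_angle f F"
  define S where "S = {m. m < l \<and> sin (?\<Theta> m) = 0}"
  note mono = total_angle_strict_mono[OF assms(1,2)]
  have "?\<Theta> ` S = (\<lambda>k. pi * real k) ` {1..<N}"
  proof (intro equalityI subsetI)
    fix t assume "t \<in> ?\<Theta> ` S"
    then obtain m where m: "m < l" "sin (?\<Theta> m) = 0" "t = ?\<Theta> m" by (auto simp: S_def)
    then obtain i :: int where i: "t = of_int i * pi" by (auto simp: sin_zero_iff_int2)
    have "0 < t"
      using total_angle_gt[of f m F] m(3) by (smt (verit) mult_nonneg_nonneg of_nat_0_le_iff pi_ge_zero)
    moreover have "t < real N * pi"
      using strict_monoD[OF mono m(1)] assms(3) m(3) by (simp add: mult.commute)
    ultimately have "0 < i" "i < int N"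
      unfolding i by (simp_all add: zero_less_mult_iff)
    then show "t \<in> (\<lambda>k. pi * real k) ` {1..<N}"
      by (intro image_eqI[of _ _ "nat i"]) (auto simp: i mult.commute)
  next
    fix t assume "t \<in> (\<lambda>k. pi * real k) ` {1..<N}"
    then obtain k where k: "1 \<le> k" "k < N" "t = pi * real k" by auto
    have "pi * 1 \<le> t" "t < ?\<Theta> l"
      unfolding k(3) assms(3) using k by (intro mult_left_mono mult_strict_left_mono; simp)+
    obtain l\<^sub>0 where l\<^sub>0: "\<And>l. l \<le> l\<^sub>0 \<Longrightarrow> ?\<Theta> l < pi"
      using total_angle_lt_pi[OF assms(1,2)] by blast
    have "\<exists>m. min l\<^sub>0 l \<le> m \<and> m \<le> l \<and> ?\<Theta> m = t"
      using l\<^sub>0[of "min l\<^sub>0 l"] \<open>pi * 1 \<le> t\<close> \<open>t < ?\<Theta> l\<close>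
      by (intro IVT) (auto intro!: isCont_total_angle assms)
    then obtain m where m: "m \<le> l" "?\<Theta> m = t" by blast
    have "m \<in> S"
      unfolding S_def using m \<open>t < ?\<Theta> l\<close> by (auto simp: k(3) less_le)
    then show "t \<in> ?\<Theta> ` S" using m by blast
  qed
  moreover have "inj_on ?\<Theta> S"
    by (rule strict_mono_imp_inj_on[OF mono])
  moreover have "inj_on (\<lambda>k. pi * real k) {1..<N}"
    by (auto simp: inj_on_def)
  ultimately have "card S = card {1..<N}"
    by (metis card_image)
  then show ?thesis by (simp add: S_def)
qed

text \<open>The angle maps the zeros bijectively onto the multiples of \<pi> strictly between its
  end values: each such multiple is attained by continuity, and only once since it is crossed
  upwards.\<close>

lemma angle_zeros:
  assumes "total_angle f F l = pi * real N"
  defines "Z \<equiv> {x \<in> {0<..<pi}. sin (angle (boundary_angle f l) l x) = 0}"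
  shows "finite Z" and "int (card Z) = int N - 1 - int (pole_count f l) - int (pole_count F l)"
proof -
  define \<theta> where "\<theta> = angle (boundary_angle f l) l"
  define p P where "p = pole_count f l" and "P = pole_count F l"
  have p: "pi * real p \<le> \<theta> 0" "\<theta> 0 < pi * real (p + 1)"
    using boundary_angle_bounds[of f l] by (simp_all add: \<theta>_def p_def angle_0)
  have P: "pi * real N - pi * real (P + 1) < \<theta> pi" "\<theta> pi \<le> pi * real N - pi * real P"
    using boundary_angle_bounds[of "add_const (- Q pi) F" l] assms(1)
    by (simp_all add: total_angle_def \<theta>_def P_def pole_count_add_const)
  have "pi * real (p + P) < pi * real N"
    using total_angle_gt[of f l F] assms(1) by (simp add: p_def P_def)
  then have "p + P < N" by simp
  have Z: "Z = {x \<in> {0<..<pi}. sin (\<theta> x) = 0}" by (simp add: Z_def \<theta>_def)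
  have incr: "\<theta> x < \<theta> y" if "x \<in> Z" "x < y" "y \<le> pi" for x y
    unfolding \<theta>_def using that by (intro angle_crossing[where x\<^sub>0 = x]) (auto simp: Z \<theta>_def)
  have "\<theta> ` Z = (\<lambda>k. pi * real k) ` {p + 1..<N - P}"
  proof (intro equalityI subsetI)
    fix t assume "t \<in> \<theta> ` Z"
    then obtain x where x: "x \<in> Z" "t = \<theta> x" by blast
    then obtain i :: int where i: "t = of_int i * pi" by (auto simp: sin_zero_iff_int2 Z)
    \<comment> \<open>The multiple \<open>pi * real p\<close> is excluded even if it is the initial
      angle, since the angle leaves it at once.\<close>
    have "pi * real p < t"
      unfolding x(2) \<theta>_def using p(1) x(1)
      by (intro angle_crossing[where x\<^sub>0 = 0]) (auto simp: \<theta>_def Z)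
    then have "real p < of_int i" by (simp add: i mult.commute[of pi])
    \<comment> \<open>The multiple with index \<open>N - P\<close> can be reached only at
      \<open>pi\<close> itself, since the angle rises strictly after a zero.\<close>
    have "t < pi * (real N - real P)"
      using incr[OF x(1), of pi] x P(2) by (simp add: Z right_diff_distrib)
    then have "of_int i < real N - real P" by (simp add: i mult.commute[of pi])
    then have "int p < i" "i < int N - int P"
      using \<open>real p < of_int i\<close> by linarith+
    then show "t \<in> (\<lambda>k. pi * real k) ` {p + 1..<N - P}"
      by (intro image_eqI[of _ _ "nat i"]) (auto simp: i mult.commute)
  next
    fix t assume "t \<in> (\<lambda>k. pi * real k) ` {p + 1..<N - P}"
    then obtain k where "k \<in> {p + 1..<N - P}" and t_eq: "t = pi * real k" by blast
    then have k: "p + 1 \<le> k" "k + P + 1 \<le> N" by auto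
    have "pi * real (p + 1) \<le> t"
      unfolding t_eq using k(1) by (intro mult_left_mono) auto
    moreover have "pi * real (k + P + 1) \<le> pi * real N"
      using k(2) by (intro mult_left_mono) auto
    ultimately have t: "\<theta> 0 < t" "t < \<theta> pi"
      using p(2) P(1) by (auto simp: t_eq distrib_left)
    moreover have "continuous_on {0..pi} \<theta>"
      unfolding \<theta>_def by (rule continuous_on_angle)
    ultimately have "\<exists>x. 0 \<le> x \<and> x \<le> pi \<and> \<theta> x = t"
      by (intro IVT') auto
    then obtain x where x: "0 \<le> x" "x \<le> pi" "\<theta> x = t" by blast
    then have "0 < x" "x < pi" using t by (auto simp: less_le)
    moreover have "sin t = 0" by (simp add: t_eq)
    ultimately show "t \<in> \<theta> ` Z" using x(3) by (auto simp: Z)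
  qed
  moreover have inj: "inj_on \<theta> Z"
    by (rule linorder_inj_onI') (use incr in \<open>force simp: Z\<close>)
  moreover have "inj_on (\<lambda>k. pi * real k) {p + 1..<N - P}"
    by (auto simp: inj_on_def)
  ultimately have card: "card Z = card {p + 1..<N - P}" and "finite (\<theta> ` Z)"
    by (metis card_image, simp)
  show "finite Z" using \<open>finite (\<theta> ` Z)\<close> inj by (rule finite_imageD)
  show "int (card Z) = int N - 1 - int (pole_count f l) - int (pole_count F l)"
    using card \<open>p + P < N\<close> by (simp add: p_def P_def)
qed

end

section \<open>Identification of the index of the eigenvalue and the zero count\<close>

theorem theorem4p4:
  fixes q :: "real \<Rightarrow> real" and f F :: rfun
    and ev :: "nat \<Rightarrow> real" and n :: nat and y :: "real \<Rightarrow> complex"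
  assumes "set_integrable lebesgue {0<..<pi} q"
    and "in_R f" and "in_R F"
    and "strict_mono ev"
    and "eigenvalues q f F = range (\<lambda>k. complex_of_real (ev k))"
    and "eigenfunction q f F (complex_of_real (ev n)) y"
  shows "finite {x \<in> {0<..<pi}. y x = 0} \<and>
    int (card {x \<in> {0<..<pi}. y x = 0}) =
      int n - int (pole_count f (ev n)) - int (pole_count F (ev n))"
proof -
  interpret potential q
    by unfold_locales (use assms(1) absolutely_integrable_on_Icc_iff_Ioo in blast)
  let ?\<Theta> = "total_angle f F"
  have eigenvalue_iff: "sin (?\<Theta> l) = 0 \<longleftrightarrow> (\<exists>k. l = ev k)" for l
  proof -
    have "sin (?\<Theta> l) = 0 \<longleftrightarrow> of_real l \<in> eigenvalues q f F"
      using eigenvalue_if_total_angle[OF assms(2,3)] eigenfunction_angle(1)[OF assms(2,3)]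
      by (auto simp: eigenvalues_def)
    then show ?thesis by (auto simp: assms(5))
  qed
  then obtain i :: int where i: "?\<Theta> (ev n) = of_int i * pi"
    by (metis sin_zero_iff_int2)
  have "0 < ?\<Theta> (ev n)"
    using total_angle_gt[of f "ev n" F] by (smt (verit) mult_nonneg_nonneg of_nat_0_le_iff pi_ge_zero)
  then have "0 < i" by (simp add: i zero_less_mult_iff)
  define N where "N = nat i"
  have N: "?\<Theta> (ev n) = pi * real N" and "1 \<le> N"
    using \<open>0 < i\<close> by (simp_all add: N_def i)
  \<comment> \<open>Exactly \<open>n\<close> eigenvalues lie below \<open>ev n\<close>, whereas the
    total angle counts \<open>N - 1\<close> of them; hence \<open>N = n + 1\<close>.\<close>
  have "{m. m < ev n \<and> sin (?\<Theta> m) = 0} = ev ` {..<n}"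
    using strict_mono_less[OF assms(4)] by (auto simp: eigenvalue_iff)
  then have "n = N - 1"
    using card_eigenvalues_below[OF assms(2,3) N] card_image[of ev "{..<n}"]
      strict_mono_imp_inj_on[OF assms(4)] by simp
  moreover have "{x \<in> {0<..<pi}. y x = 0} =
      {x \<in> {0<..<pi}. sin (angle (boundary_angle f (ev n)) (ev n) x) = 0}"
    using eigenfunction_angle(2)[OF assms(2,3,6)] by auto
  ultimately show ?thesis
    using angle_zeros[OF N] \<open>1 \<le> N\<close> by simp
qed

end
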